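(* Let $m\geq0$, $r\geq2$ and $0\leq i\leq r$ be integers. Then \[ \sum_{s_1\geq\dots\geq s_{r}\geq-\lfloor m/2\rfloor}\frac{q^{s_1^2+\dots+s_{r}^2+m(s_1+\dots+s_{r-1})-s_1-\dots-s_{i}}(-q)_{m+2s_r-1}}{(q)_{s_1-s_2}\cdots(q)_{s_{r-2}-s_{r-1}}(q^2;q^2)_{s_{r-1}-s_{r}}}(-1)^{s_r}\begin{bmatrix}m+s_r\\ m+2s_r\end{bmatrix}_{q^2}=a_m, \] where (the sum on the left running over integers $s_1,\dots,s_r$, and $s_1+\dots+s_i=0$ when $i=0$) for every integer $p\ge0$, \[ a_{2p}=\sum_{k=0}^{i}\sum_{\ell=0}^{2p}(-1)^\ell q^{2pk+2p\ell}\frac{(q^{2r},q^{2p(r-1)+r-i+2k+2\ell},q^{r+i-2p(r-1)-2k-2\ell};q^{2r})_\infty}{2(q)_\infty}, \] \[ a_{2p+1}=(-1)^pq^{(2-r)p^2+(1+i-r)p}\sum_{\ell=0}^{p}q^{2\ell}\frac{(q^{2r},q^{2r-2p-1-i+4\ell},q^{i+2p+1-4\ell};q^{2r})_\infty}{(q)_\infty}. \]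
   Context: $q$ is a complex number with $|q|<1$. For complex $x$ and base $p'$ with $|p'|<1$, $(x;p')_\infty=\prod_{j\ge0}(1-xp'^j)$, $(x;p')_k=(x;p')_\infty/(xp'^k;p')_\infty$ for $k\in\mathbb{Z}$ (e.g. $(-q)_{-1}=1/2$), $(x)_k=(x;q)_k$, and $(x_1,\dots,x_m;p')_\infty=\prod_i(x_i;p')_\infty$. For integers $N\ge0$ and $j$, $\begin{bmatrix}N\\ j\end{bmatrix}_{q^2}=\frac{(q^2;q^2)_N}{(q^2;q^2)_j(q^2;q^2)_{N-j}}$ if $0\le j\le N$ and $0$ otherwise.
   Formalization: The range is 0≤i≤r−1 instead of 0≤i≤r, since the identity fails at i=r (for m=0, r=i=2 the left side tends to 1 and the right to 1/2 as q→0); also q≠0 is assumed, since negative powers of q occur. *)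

theory Defs
  imports "HOL-Analysis.Analysis"
begin

definition qpoch_inf :: "complex \<Rightarrow> complex \<Rightarrow> complex" where
  "qpoch_inf x p = prodinf (\<lambda>j. 1 - x * p ^ j)"

definition qpoch_infs :: "complex list \<Rightarrow> complex \<Rightarrow> complex" where
  "qpoch_infs xs p = (\<Prod>x\<leftarrow>xs. qpoch_inf x p)"

text \<open>The finite symbol has an integer index; for \<open>k < 0\<close> the definition is meaningful only
  for \<open>p \<noteq> 0\<close>, since \<open>0 powi k = 0\<close> by convention.\<close>

definition qpoch :: "complex \<Rightarrow> complex \<Rightarrow> int \<Rightarrow> complex" where
  "qpoch x p k = qpoch_inf x p / qpoch_inf (x * p powi k) p"

definition qbinom :: "complex \<Rightarrow> int \<Rightarrow> int \<Rightarrow> complex" where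
  "qbinom p N j =
     (if 0 \<le> j \<and> j \<le> N then qpoch p p N / (qpoch p p j * qpoch p p (N - j)) else 0)"

definition a_even :: "complex \<Rightarrow> nat \<Rightarrow> nat \<Rightarrow> nat \<Rightarrow> complex" where
  "a_even q r i p =
     (\<Sum>k=0..i. \<Sum>l=0..2*p. (-1) ^ l * q ^ (2*p*k + 2*p*l) *
        (qpoch_infs
           [q ^ (2*r),
            q powi (2 * int p * (int r - 1) + int r - int i + 2 * int k + 2 * int l),
            q powi (int r + int i - 2 * int p * (int r - 1) - 2 * int k - 2 * int l)]
           (q ^ (2*r))
         / (2 * qpoch_inf q q)))"

definition a_odd :: "complex \<Rightarrow> nat \<Rightarrow> nat \<Rightarrow> nat \<Rightarrow> complex" where
  "a_odd q r i p =
     (-1) ^ p * q powi ((2 - int r) * (int p)\<^sup>2 + (1 + int i - int r) * int p) *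
     (\<Sum>l=0..p. q ^ (2*l) *
        (qpoch_infs
           [q ^ (2*r),
            q powi (2 * int r - 2 * int p - 1 - int i + 4 * int l),
            q powi (int i + 2 * int p + 1 - 4 * int l)]
           (q ^ (2*r))
         / qpoch_inf q q))"

definition a_seq :: "complex \<Rightarrow> nat \<Rightarrow> nat \<Rightarrow> nat \<Rightarrow> complex" where
  "a_seq q r i m = (if even m then a_even q r i (m div 2) else a_odd q r i (m div 2))"

text \<open>The tuples \<open>(s\<^sub>1, \<dots>, s\<^sub>r)\<close> are extensional functions on \<open>{1..r}\<close>, so that each tuple is
  represented exactly once.\<close>

definition index_tuples :: "nat \<Rightarrow> nat \<Rightarrow> (nat \<Rightarrow> int) set" where
  "index_tuples m r =
     {s \<in> {1..r} \<rightarrow>\<^sub>E UNIV. (\<forall>j\<in>{1..<r}. s j \<ge> s (Suc j)) \<and> s r \<ge> - \<lfloor>real m / 2\<rfloor>}"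

end

theory Submission
  imports Defs
begin

text \<open>
  Put \<open>a = q\<^sup>m\<close> and \<open>K\<^sub>n\<^sub>,\<^sub>j = 1 / ((q)\<^sub>n\<^sub>-\<^sub>j (q)\<^sub>n\<^sub>+\<^sub>j\<^sub>+\<^sub>m)\<close>, so that sequences
  related by \<open>\<beta>\<^sub>n = \<Sum>\<^sub>j \<alpha>\<^sub>j K\<^sub>n\<^sub>,\<^sub>j\<close> (\<open>j\<close> running over all integers) form a bilateral Bailey pair.
  The q-binomial theorem evaluates the factor \<open>(-1)\<^sup>s q\<^sup>s\<^sup>(\<^sup>s\<^sup>-\<^sup>1\<^sup>)\<close> times the binomial coefficient
  as the \<open>\<beta>\<close>-side of a pair in base \<open>q\<^sup>2\<close>; a quadratic change of base turns the sum over \<open>s\<^sub>r\<close> into the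
  \<open>\<beta>\<close>-side of a pair in base \<open>q\<close> with \<open>\<alpha>\<^sub>j = (-1)\<^sup>j q\<^sup>j\<^sup>2 / (1 + q\<^sup>2\<^sup>j\<^sup>+\<^sup>m)\<close>. Each sum over
  \<open>s\<^sub>r\<^sub>-\<^sub>1, \<dots>, s\<^sub>1\<close> is then one step of the Bailey chain. The linear terms \<open>-s\<^sub>1 - \<dots> - s\<^sub>i\<close> are absorbed
  by keeping the kernel \<open>K\<close> but with an additional factor \<open>A\<^sub>e\<^sub>+\<^sub>1(y) - q\<^sup>n\<^sup>+\<^sup>j\<^sup>+\<^sup>m A\<^sub>e(y)\<close>, where
  \<open>A\<^sub>e(y) = 1 + y + \<dots> + y\<^sup>e\<^sup>-\<^sup>1\<close> and \<open>y = q\<^sup>2\<^sup>j\<^sup>+\<^sup>m\<close>; this also covers \<open>2j + m = 0\<close>, where the usual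
  Bailey lattice would divide by zero. Letting the upper bound of \<open>s\<^sub>1\<close> tend to infinity leaves a
  bilateral sum over \<open>j\<close>; averaging it with its reflection \<open>j \<mapsto> -m - j\<close> makes the denominator
  \<open>1 + y\<close> cancel, and the Jacobi triple product gives the infinite products.
\<close>

section \<open>Terminating q-series\<close>

definition qfac :: "complex \<Rightarrow> nat \<Rightarrow> complex" where
  "qfac q n = (\<Prod>i<n. 1 - q ^ Suc i)"

lemma qfac_0 [simp]: "qfac q 0 = 1"
  and qfac_Suc: "qfac q (Suc n) = qfac q n * (1 - q ^ Suc n)"
  by (simp_all add: qfac_def)

lemma one_minus_power_nonzero:
  fixes q :: complex
  assumes "norm q < 1" "n > 0"
  shows "1 - q ^ n \<noteq> 0"
proof
  assume "1 - q ^ n = 0"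
  hence "norm q ^ n = 1"
    by (metis eq_iff_diff_eq_0 norm_one norm_power)
  with assms show False
    by (metis norm_ge_zero power_less_one_iff less_irrefl)
qed

lemma one_plus_power_nonzero:
  fixes q :: complex
  assumes "norm q < 1"
  shows "1 + q ^ n \<noteq> 0"
proof (cases "n = 0")
  case False
  show ?thesis
  proof
    assume "1 + q ^ n = 0"
    hence "q ^ n = - 1"
      by (simp add: add_eq_0_iff)
    hence "norm q ^ n = 1"
      by (metis norm_minus_cancel norm_one norm_power)
    with assms False show False
      by (metis norm_ge_zero power_less_one_iff less_irrefl neq0_conv)
  qed
qed auto

lemma qfac_nonzero [simp]: "norm q < 1 \<Longrightarrow> qfac q n \<noteq> 0"
  using one_minus_power_nonzero[of q "Suc _"] by (simp add: qfac_def del: power_Suc)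

text \<open>The q-Pascal rule, from
  \<open>1 - q^(n+1) = (1 - q^(n-t)) + q^(n-t) (1 - q^(t+1))\<close>. At \<open>t = n\<close> the
  first part vanishes, which truncated subtraction would hide; hence the case distinction.\<close>

lemma qfac_pascal:
  assumes "norm q < 1" "t \<le> n"
  shows "(1 - q ^ Suc n) / (qfac q (Suc n - Suc t) * qfac q (Suc t)) =
     (if Suc t \<le> n then 1 / (qfac q (n - Suc t) * qfac q (Suc t)) else 0)
     + q ^ (n - t) / (qfac q (n - t) * qfac q t)"
proof -
  have nz: "1 - q * q ^ k \<noteq> 0" for k
    using one_minus_power_nonzero[of q "Suc k"] assms by simp
  show ?thesis
  proof (cases "Suc t \<le> n")
    case True
    then obtain d where d: "n = Suc t + d"
      using le_Suc_ex by blast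
    have "n - t = Suc d" "n - Suc t = d" "Suc n - Suc t = Suc d"
      using d by auto
    then show ?thesis
      using assms nz[of d] nz[of t] True
      by (simp add: qfac_Suc divide_simps) (simp add: d power_add algebra_simps)
  next
    case False
    then have "t = n"
      using assms by auto
    then show ?thesis
      using assms nz[of n] by (simp add: qfac_Suc)
  qed
qed

text \<open>Drives the next three inductions on the upper limit: q-Pascal splits off the same sum
  with limit \<open>M\<close> and one in which \<open>f\<close> is shifted by one.\<close>

lemma qfac_sum_step:
  fixes f :: "nat \<Rightarrow> complex"
  assumes "norm q < 1"
  shows "(1 - q ^ Suc M) * (\<Sum>t\<le>Suc M. f t / (qfac q (Suc M - t) * qfac q t)) =
    (\<Sum>t\<le>M. f t / (qfac q (M - t) * qfac q t))
    + (\<Sum>t\<le>M. f (Suc t) * q ^ (M - t) / (qfac q (M - t) * qfac q t))"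
proof -
  have nz: "1 - q * q ^ k \<noteq> 0" for k
    using one_minus_power_nonzero[of q "Suc k"] assms by simp
  let ?g = "\<lambda>t. if t \<le> M then f t / (qfac q (M - t) * qfac q t) else 0"
  have "(1 - q ^ Suc M) * (\<Sum>t\<le>Suc M. f t / (qfac q (Suc M - t) * qfac q t)) =
      (1 - q ^ Suc M) * f 0 / qfac q (Suc M) +
      (\<Sum>t\<le>M. f (Suc t) * ((1 - q ^ Suc M) / (qfac q (Suc M - Suc t) * qfac q (Suc t))))"
    by (subst sum.atMost_Suc_shift) (simp add: algebra_simps sum_distrib_left)
  also have "(1 - q ^ Suc M) * f 0 / qfac q (Suc M) = ?g 0"
    using nz[of M] assms by (simp add: qfac_Suc)
  also have "(\<Sum>t\<le>M. f (Suc t) * ((1 - q ^ Suc M) / (qfac q (Suc M - Suc t) * qfac q (Suc t)))) =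
     (\<Sum>t\<le>M. ?g (Suc t) + f (Suc t) * q ^ (M - t) / (qfac q (M - t) * qfac q t))"
    by (intro sum.cong refl, subst qfac_pascal) (use assms in \<open>auto simp: algebra_simps\<close>)
  also have "\<dots> = (\<Sum>t\<le>M. ?g (Suc t)) + (\<Sum>t\<le>M. f (Suc t) * q ^ (M - t) / (qfac q (M - t) * qfac q t))"
    by (rule sum.distrib)
  finally have "(1 - q ^ Suc M) * (\<Sum>t\<le>Suc M. f t / (qfac q (Suc M - t) * qfac q t)) =
     (?g 0 + (\<Sum>t\<le>M. ?g (Suc t))) + (\<Sum>t\<le>M. f (Suc t) * q ^ (M - t) / (qfac q (M - t) * qfac q t))"
    by (simp only: add.assoc)
  also have "?g 0 + (\<Sum>t\<le>M. ?g (Suc t)) = (\<Sum>t\<le>Suc M. ?g t)"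
    by (rule sum.atMost_Suc_shift [symmetric])
  also have "\<dots> = (\<Sum>t\<le>M. f t / (qfac q (M - t) * qfac q t))"
    by simp
  finally show ?thesis .
qed

text \<open>A limiting case of q-Chu-Vandermonde. Shifting \<open>t\<close> turns \<open>c\<close>
  into \<open>c + 1\<close>, so the induction on \<open>M\<close> keeps \<open>c\<close>
  arbitrary.\<close>

lemma q_vandermonde_sum:
  assumes "norm q < 1"
  shows "(\<Sum>t\<le>M. q ^ (t * t + c * t) / (qfac q (M - t) * qfac q t * qfac q (t + c))) =
     1 / (qfac q M * qfac q (M + c))"
proof (induction M arbitrary: c)
  case (Suc M)
  define S where "S = (\<lambda>M c. \<Sum>t\<le>M. q ^ (t * t + c * t) / (qfac q (M - t) * qfac q t * qfac q (t + c)))"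
  have nz: "1 - q * q ^ k \<noteq> 0" for k
    using one_minus_power_nonzero[of q "Suc k"] assms by simp
  have "(1 - q ^ Suc M) * S (Suc M) c = S M c +
     (\<Sum>t\<le>M. (q ^ (Suc t * Suc t + c * Suc t) / qfac q (Suc t + c)) * q ^ (M - t)
                / (qfac q (M - t) * qfac q t))"
    using qfac_sum_step[OF assms, of M "\<lambda>t. q ^ (t * t + c * t) / qfac q (t + c)"]
    by (simp add: S_def mult_ac)
  also have "(\<Sum>t\<le>M. (q ^ (Suc t * Suc t + c * Suc t) / qfac q (Suc t + c)) * q ^ (M - t)
                / (qfac q (M - t) * qfac q t)) = q ^ (M + Suc c) * S M (Suc c)"
    unfolding S_def sum_distrib_left
  proof (intro sum.cong refl)
    fix t assume "t \<in> {..M}"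
    then have e: "Suc t * Suc t + c * Suc t + (M - t) = M + Suc c + (t * t + Suc c * t)"
      by (simp add: algebra_simps)
    have "q ^ (Suc t * Suc t + c * Suc t) * q ^ (M - t) = q ^ (M + Suc c) * q ^ (t * t + Suc c * t)"
      by (simp only: power_add [symmetric] e)
    then show "q ^ (Suc t * Suc t + c * Suc t) / qfac q (Suc t + c) * q ^ (M - t) /
         (qfac q (M - t) * qfac q t) =
         q ^ (M + Suc c) * (q ^ (t * t + Suc c * t) / (qfac q (M - t) * qfac q t * qfac q (t + Suc c)))"
      by (simp del: mult_Suc mult_Suc_right)
  qed
  finally have "(1 - q ^ Suc M) * S (Suc M) c = S M c + q ^ (M + Suc c) * S M (Suc c)" .
  moreover have S_eq: "S M C = 1 / (qfac q M * qfac q (M + C))" for C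
    unfolding S_def by (rule Suc)
  ultimately have "S (Suc M) c = (S M c + q ^ (M + Suc c) * S M (Suc c)) / (1 - q ^ Suc M)"
    using nz[of M] by (simp add: field_simps)
  also have "\<dots> = 1 / (qfac q (Suc M) * qfac q (Suc M + c))"
    using nz[of M] nz[of "M + c"] assms
    unfolding S_eq
    by (simp add: qfac_Suc divide_simps power_add)
  finally show ?case
    unfolding S_def .
qed auto

text \<open>The companion with \<open>q^(-t)\<close> inserted, which serves the linear terms
  \<open>-s_j\<close>. Its three-term numerator is what later brings the factors \<open>A_e\<close>
  into the chain.\<close>

lemma q_vandermonde_sum_shifted:
  assumes "norm q < 1"
  shows "(\<Sum>t\<le>M. q ^ (t * (t - 1) + c * t) / (qfac q (M - t) * qfac q t * qfac q (t + c))) =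
     (1 + q ^ c - q ^ (M + c)) / (qfac q M * qfac q (M + c))"
proof (induction M arbitrary: c)
  case (Suc M)
  define S where "S = (\<lambda>M c. \<Sum>t\<le>M. q ^ (t * (t - 1) + c * t) / (qfac q (M - t) * qfac q t * qfac q (t + c)))"
  have nz: "1 - q * q ^ k \<noteq> 0" for k
    using one_minus_power_nonzero[of q "Suc k"] assms by simp
  have "(1 - q ^ Suc M) * S (Suc M) c = S M c +
     (\<Sum>t\<le>M. (q ^ (Suc t * t + c * Suc t) / qfac q (Suc t + c)) * q ^ (M - t)
                / (qfac q (M - t) * qfac q t))"
    using qfac_sum_step[OF assms, of M "\<lambda>t. q ^ (t * (t - 1) + c * t) / qfac q (t + c)"]
    by (simp add: S_def mult_ac)
  also have "(\<Sum>t\<le>M. (q ^ (Suc t * t + c * Suc t) / qfac q (Suc t + c)) * q ^ (M - t)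
                / (qfac q (M - t) * qfac q t)) = q ^ (M + c) * S M (Suc c)"
    unfolding S_def sum_distrib_left
  proof (intro sum.cong refl)
    fix t assume "t \<in> {..M}"
    then have e: "Suc t * t + c * Suc t + (M - t) = M + c + (t * (t - 1) + Suc c * t)"
      by (cases t) (simp_all add: algebra_simps)
    have "q ^ (Suc t * t + c * Suc t) * q ^ (M - t) = q ^ (M + c) * q ^ (t * (t - 1) + Suc c * t)"
      by (simp only: power_add [symmetric] e)
    then show "q ^ (Suc t * t + c * Suc t) / qfac q (Suc t + c) * q ^ (M - t) /
         (qfac q (M - t) * qfac q t) =
         q ^ (M + c) * (q ^ (t * (t - 1) + Suc c * t) / (qfac q (M - t) * qfac q t * qfac q (t + Suc c)))"
      by (simp del: mult_Suc mult_Suc_right)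
  qed
  finally have "(1 - q ^ Suc M) * S (Suc M) c = S M c + q ^ (M + c) * S M (Suc c)" .
  moreover have S_eq: "S M C = (1 + q ^ C - q ^ (M + C)) / (qfac q M * qfac q (M + C))" for C
    unfolding S_def by (rule Suc)
  ultimately have "S (Suc M) c = (S M c + q ^ (M + c) * S M (Suc c)) / (1 - q ^ Suc M)"
    using nz[of M] by (simp add: field_simps)
  also have "\<dots> = (1 + q ^ c - q ^ (Suc M + c)) / (qfac q (Suc M) * qfac q (Suc M + c))"
    using nz[of M] nz[of "M + c"] assms
    unfolding S_eq
    by (simp add: qfac_Suc divide_simps power_add) (simp add: algebra_simps)
  finally show ?case
    unfolding S_def .
qed auto

text \<open>The numerator satisfies \<open>f (t+1) q^(n-t) = -x q^n f t\<close>, so the two sums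
  produced by \<open>qfac_sum_step\<close> are proportional and each induction step contributes
  \<open>1 - x q^n\<close>.\<close>

lemma q_binomial_sum:
  assumes "norm q < 1"
  shows "(\<Sum>t\<le>n. (-1) ^ t * q ^ (t * (t - 1) div 2) * x ^ t / (qfac q (n - t) * qfac q t)) =
     (\<Prod>i<n. 1 - x * q ^ i) / qfac q n"
proof (induction n arbitrary: x)
  case (Suc n)
  define f where "f = (\<lambda>x t. (-1) ^ t * q ^ (t * (t - 1) div 2) * x ^ t)"
  have nz: "1 - q * q ^ k \<noteq> 0" for k
    using one_minus_power_nonzero[of q "Suc k"] assms by simp
  have f: "f x (Suc t) * q ^ (n - t) = - x * q ^ n * f x t" if "t \<le> n" for t
  proof -
    have "Suc t * t div 2 = t * (t - 1) div 2 + t"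
      by (cases t) (auto simp: algebra_simps)
    then have "Suc t * t div 2 + (n - t) = t * (t - 1) div 2 + n"
      using that by simp
    then have "q ^ (Suc t * t div 2) * q ^ (n - t) = q ^ (t * (t - 1) div 2) * q ^ n"
      by (metis power_add)
    then show ?thesis
      by (simp add: f_def mult_ac)
  qed
  have "(1 - q ^ Suc n) * (\<Sum>t\<le>Suc n. f x t / (qfac q (Suc n - t) * qfac q t)) =
     (\<Sum>t\<le>n. f x t / (qfac q (n - t) * qfac q t)) + (\<Sum>t\<le>n. - x * q ^ n * (f x t / (qfac q (n - t) * qfac q t)))"
    by (subst qfac_sum_step[OF assms]) (simp add: f)
  also have "\<dots> = (1 - x * q ^ n) * (\<Sum>t\<le>n. f x t / (qfac q (n - t) * qfac q t))"
    by (simp only: sum_distrib_left [symmetric]) (simp add: algebra_simps)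
  also have "(\<Sum>t\<le>n. f x t / (qfac q (n - t) * qfac q t)) = (\<Prod>i<n. 1 - x * q ^ i) / qfac q n"
    using Suc[of x] by (simp add: f_def)
  finally have "(1 - q ^ Suc n) * (\<Sum>t\<le>Suc n. f x t / (qfac q (Suc n - t) * qfac q t)) =
    (1 - x * q ^ n) * ((\<Prod>i<n. 1 - x * q ^ i) / qfac q n)" .
  then have "(\<Sum>t\<le>Suc n. f x t / (qfac q (Suc n - t) * qfac q t)) =
    (1 - x * q ^ n) * ((\<Prod>i<n. 1 - x * q ^ i) / qfac q n) / (1 - q ^ Suc n)"
    using nz[of n] by (subst eq_divide_eq) (simp add: mult.commute del: sum.atMost_Suc)
  also have "\<dots> = (\<Prod>i<Suc n. 1 - x * q ^ i) / qfac q (Suc n)"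
    by (simp add: qfac_Suc)
  finally show ?case
    unfolding f_def .
qed auto

unbundle no vec_syntax and fps_syntax

text \<open>The sum is a convolution in \<open>M\<close>. The series \<open>y(x)\<close> with coefficients \<open>1 / ((q)\<^sub>M (q)\<^sub>M\<^sub>+\<^sub>c)\<close>
  satisfies \<open>(1 - x) y(x) - (1 + z) y(qx) + z y(q\<^sup>2x) = 0\<close> with \<open>z = q\<^sup>c\<close>. Eliminating \<open>y(qx)\<close> and
  \<open>y(q\<^sup>3x)\<close> between this and its shifts shows that \<open>(x; q\<^sup>2)\<^sub>\<infinity> y(x)\<close> satisfies a \<open>q\<^sup>2\<close>-difference equation
  that is a two-term recurrence for its coefficients.\<close>

lemma quadratic_base_change_sum:
  assumes q: "norm q < 1"
  shows "(\<Sum>t\<le>M. q ^ t * (\<Prod>i<c + 2 * t. 1 + q ^ i) /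
            (qfac (q\<^sup>2) (M - t) * qfac (q\<^sup>2) t * qfac (q\<^sup>2) (t + c))) =
         2 / ((1 + q ^ c) * qfac q M * qfac q (M + c))"
proof -
  have q2: "norm (q\<^sup>2) < 1"
    using q by (simp add: norm_power power_less_one_iff)
  define z where "z = q ^ c"
  \<comment> \<open>\<open>D\<close> is the q-shift sending \<open>f(x)\<close> to
    \<open>f(q x)\<close>. Up to the factor \<open>2 / (1 + z)\<close>, \<open>v\<close> is the
    claimed right-hand side, and \<open>e\<close> is \<open>1 / (x; q^2)_inf\<close>.\<close>
  define D where "D = (\<lambda>f :: complex fps. f oo (fps_const q * fps_X))"
  have D_nth: "D f $ n = q ^ n * f $ n" for f n
    by (simp add: D_def fps_compose_linear)
  have D_mult: "D (f * g) = D f * D g" for f g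
    by (simp add: D_def fps_compose_mult_distrib)
  have D_1: "D 1 = 1" and D_add: "D (f + g) = D f + D g" and D_diff: "D (f - g) = D f - D g"
    and D_0: "D 0 = 0" for f g
    by (simp_all add: fps_eq_iff D_nth algebra_simps)
  define v where "v = (\<lambda>n. 1 / (qfac q n * qfac q (n + c)))"
  define y where "y = Abs_fps v"
  define e where "e = Abs_fps (\<lambda>n. 1 / qfac (q\<^sup>2) n)"
  define X Q Z where "X = (fps_X :: complex fps)" and "Q = fps_const q" and "Z = fps_const z"
  have D_consts: "D X = Q * X" "D Q = Q" "D Z = Z"
    by (auto simp: fps_eq_iff D_nth X_def Q_def Z_def le_Suc_eq)
  have v_Suc: "v (Suc n) * ((1 - q ^ Suc n) * (1 - z * q ^ Suc n)) = v n" for n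
  proof -
    define A B where "A = 1 - q ^ Suc n" and "B = 1 - q ^ Suc (n + c)"
    have "A \<noteq> 0" "B \<noteq> 0"
      unfolding A_def B_def by (rule one_minus_power_nonzero[OF q], simp)+
    moreover have "1 - z * q ^ Suc n = B"
      by (simp add: B_def z_def power_add)
    ultimately show ?thesis
      unfolding v_def add_Suc qfac_Suc A_def[symmetric] B_def[symmetric] by simp
  qed
  have E0: "(1 - X) * y - (1 + Z) * D y + Z * D (D y) = 0"
  proof (rule fps_ext)
    fix n
    show "((1 - X) * y - (1 + Z) * D y + Z * D (D y)) $ n = 0 $ n"
    proof (cases n)
      case 0
      then show ?thesis
        by (simp add: algebra_simps X_def Z_def D_nth)
    next
      case (Suc k)
      have "((1 - X) * y - (1 + Z) * D y + Z * D (D y)) $ Suc k =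
        v (Suc k) * ((1 - q ^ Suc k) * (1 - z * q ^ Suc k)) - v k"
        by (simp add: algebra_simps X_def Z_def D_nth y_def)
      then show ?thesis
        using v_Suc[of k] Suc by simp
    qed
  qed
  have E1: "(1 - Q * X) * D y - (1 + Z) * D (D y) + Z * D (D (D y)) = 0"
    using arg_cong[OF E0, of D]
    by (simp only: D_mult D_1 D_add D_diff D_0 D_consts mult.assoc)
  have E2: "(1 - Q * Q * X) * D (D y) - (1 + Z) * D (D (D y)) + Z * D (D (D (D y))) = 0"
    using arg_cong[OF E1, of D]
    by (simp only: D_mult D_1 D_add D_diff D_0 D_consts mult.assoc)
  \<comment> \<open>\<open>E0\<close> and \<open>E2\<close> express \<open>(1 + Z) * D y\<close> and
    \<open>(1 + Z) * D (D (D y))\<close> through even shifts; inserting both into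
    \<open>1 + Z\<close> times \<open>E1\<close> leaves even shifts only.\<close>
  have main: "(1 - Q * X) * ((1 - X) * y + Z * D (D y)) - (1 + Z) * (1 + Z) * D (D y)
      + Z * ((1 - Q * Q * X) * D (D y) + Z * D (D (D (D y)))) = 0"
    using E0 E1 E2 by algebra
  have e_eq: "(1 - X) * e = D (D e)"
  proof (rule fps_ext)
    fix n
    show "((1 - X) * e) $ n = D (D e) $ n"
    proof (cases n)
      case (Suc k)
      have "1 - (q\<^sup>2) ^ Suc k \<noteq> 0"
        by (rule one_minus_power_nonzero[OF q2]) simp
      then show ?thesis
        using qfac_nonzero[OF q2, of k]
        by (simp add: Suc algebra_simps X_def D_nth e_def qfac_Suc)
           (simp add: divide_simps power2_eq_square power_mult_distrib algebra_simps)
    qed (simp add: X_def e_def D_nth algebra_simps)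
  qed
  \<comment> \<open>\<open>F\<close> stands for \<open>(x; q^2)_inf\<close>. Multiplying
    \<open>main\<close> by it makes \<open>1 - X\<close> a common factor of all terms, which then
    cancels.\<close>
  define F where "F = inverse e"
  have eF: "e * F = 1"
    by (simp add: F_def e_def inverse_mult_eq_1')
  have "D (D (e * F)) = 1"
    by (simp add: eF D_1)
  then have F_eq: "(1 - X) * D (D F) = F"
    using eF unfolding D_mult e_eq[symmetric] by algebra
  have F_eq2: "(1 - Q * Q * X) * D (D (D (D F))) = D (D F)"
    using arg_cong[OF F_eq, of "\<lambda>f. D (D f)"]
    by (simp only: D_mult D_1 D_add D_diff D_0 D_consts mult.assoc)
  define W where "W = y * F"
  have "(1 - X) * ((1 - Q * X) * W + (Z * (1 - Q * X) - (1 + Z) * (1 + Z) + Z * (1 - Q * Q * X)) * D (D W)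
          + Z * Z * (1 - Q * Q * X) * D (D (D (D W)))) = 0"
    unfolding W_def D_mult using main F_eq F_eq2 by algebra
  moreover have "1 - X \<noteq> 0"
    by (metis X_def diff_eq_diff_eq diff_zero fps_X_neq_one)
  ultimately have W_eq: "(1 - Q * X) * W + (Z * (1 - Q * X) - (1 + Z) * (1 + Z) + Z * (1 - Q * Q * X)) * D (D W)
          + Z * Z * (1 - Q * Q * X) * D (D (D (D W))) = 0"
    by simp
  \<comment> \<open>Both coefficient polynomials factor: \<open>1 - (1 + z^2) Y + z^2 Y^2\<close> at
    \<open>Y = q^(2n+2)\<close> on the left, \<open>1 + z (1 + q) Y + z^2 q Y^2\<close> at
    \<open>Y = q^(2n)\<close> on the right.\<close>
  have W_Suc: "(1 - q ^ (2 * Suc n)) * (1 - q ^ (2 * Suc n + 2 * c)) * W $ Suc n =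
      q * (1 + q ^ (c + 2 * n)) * (1 + q ^ (c + 2 * n + 1)) * W $ n" for n
  proof -
    have "0 = (W - fps_const q * (fps_X * W) - (fps_const (1 + z\<^sup>2)) * D (D W)
       - fps_const (z * q) * (fps_X * D (D W)) - fps_const (z * q\<^sup>2) * (fps_X * D (D W))
       + fps_const (z\<^sup>2) * D (D (D (D W))) - fps_const (z\<^sup>2 * q\<^sup>2) * (fps_X * D (D (D (D W))))) $ Suc n"
      using arg_cong[OF W_eq, of "\<lambda>f. f $ Suc n"]
      unfolding X_def Z_def Q_def
      by (simp add: algebra_simps power2_eq_square flip: fps_const_mult fps_const_add)
    also have "\<dots> = W $ Suc n - q * W $ n - (1 + z\<^sup>2) * q ^ Suc n * q ^ Suc n * W $ Suc n
       - z * q * q ^ n * q ^ n * W $ n - z * q\<^sup>2 * q ^ n * q ^ n * W $ n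
       + z\<^sup>2 * q ^ Suc n * q ^ Suc n * q ^ Suc n * q ^ Suc n * W $ Suc n
       - z\<^sup>2 * q\<^sup>2 * q ^ n * q ^ n * q ^ n * q ^ n * W $ n"
      by (simp add: D_nth mult.assoc)
    finally show ?thesis
      unfolding z_def by (simp add: algebra_simps power_add power_mult power2_eq_square power_mult_distrib)
  qed
  \<comment> \<open>\<open>u\<close> is the part of the summand free of \<open>M\<close>. It obeys
    the recurrence of \<open>W\<close>, so only the initial values remain to be matched.\<close>
  define u where "u = (\<lambda>t. q ^ t * (\<Prod>i<c + 2 * t. 1 + q ^ i) / (qfac (q\<^sup>2) t * qfac (q\<^sup>2) (t + c)))"
  have u_Suc: "(1 - q ^ (2 * Suc n)) * (1 - q ^ (2 * Suc n + 2 * c)) * u (Suc n) =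
      q * (1 + q ^ (c + 2 * n)) * (1 + q ^ (c + 2 * n + 1)) * u n" for n
  proof -
    define A B where "A = 1 - q ^ (2 * Suc n)" and "B = 1 - q ^ (2 * Suc n + 2 * c)"
    have nz: "A \<noteq> 0" "B \<noteq> 0"
      unfolding A_def B_def by (rule one_minus_power_nonzero[OF q], simp)+
    have A: "qfac (q\<^sup>2) (Suc n) = qfac (q\<^sup>2) n * A"
      by (simp add: qfac_Suc A_def power_mult [symmetric] del: power_Suc)
    have "(q\<^sup>2) ^ Suc (n + c) = q ^ (2 * Suc n + 2 * c)"
      by (simp only: power_mult [symmetric]) (simp add: algebra_simps)
    then have B: "qfac (q\<^sup>2) (Suc n + c) = qfac (q\<^sup>2) (n + c) * B"
      by (simp add: qfac_Suc B_def del: power_Suc)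
    have C: "(\<Prod>i<c + 2 * Suc n. 1 + q ^ i) =
       (\<Prod>i<c + 2 * n. 1 + q ^ i) * (1 + q ^ (c + 2 * n)) * (1 + q ^ (c + 2 * n + 1))"
      by simp
    show ?thesis
      unfolding A_def[symmetric] B_def[symmetric] u_def A B C using nz q2
      by simp
  qed
  have u_0: "u 0 = 2 / (1 + z) * W $ 0"
  proof -
    have "(\<Prod>i<n. 1 + q ^ i) * (1 + q ^ n) * qfac q n = 2 * qfac (q\<^sup>2) n" for n
    proof (induction n)
      case (Suc n)
      have *: "(1 + q ^ Suc n) * (1 - q ^ Suc n) = 1 - (q\<^sup>2) ^ Suc n"
        by (simp add: algebra_simps power2_eq_square power_mult_distrib)
      have "(\<Prod>i<Suc n. 1 + q ^ i) * (1 + q ^ Suc n) * qfac q (Suc n) =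
        ((\<Prod>i<n. 1 + q ^ i) * (1 + q ^ n) * qfac q n) * ((1 + q ^ Suc n) * (1 - q ^ Suc n))"
        by (simp only: qfac_Suc prod.lessThan_Suc mult_ac)
      also have "\<dots> = 2 * qfac (q\<^sup>2) (Suc n)"
        unfolding Suc * by (simp only: qfac_Suc mult_ac)
      finally show ?case .
    qed auto
    from this[of c] show ?thesis
      using one_plus_power_nonzero[OF q, of c] q q2
      by (simp add: u_def W_def F_def y_def v_def e_def z_def divide_simps mult_ac)
  qed
  have u_eq: "u n = 2 / (1 + z) * W $ n" for n
  proof (induction n)
    case (Suc n)
    have nz: "(1 - q ^ (2 * Suc n)) * (1 - q ^ (2 * Suc n + 2 * c)) \<noteq> 0"
      using one_minus_power_nonzero[OF q, of "2 * Suc n"]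
        one_minus_power_nonzero[OF q, of "2 * Suc n + 2 * c"] by simp
    have "(1 - q ^ (2 * Suc n)) * (1 - q ^ (2 * Suc n + 2 * c)) * u (Suc n) =
       2 / (1 + z) * (q * (1 + q ^ (c + 2 * n)) * (1 + q ^ (c + 2 * n + 1)) * W $ n)"
      unfolding u_Suc Suc by (simp only: mult_ac)
    also have "\<dots> = (1 - q ^ (2 * Suc n)) * (1 - q ^ (2 * Suc n + 2 * c)) * (2 / (1 + z) * W $ Suc n)"
      unfolding W_Suc[symmetric] by (simp only: mult_ac)
    finally show ?case
      using nz by (metis mult_left_cancel)
  qed (use u_0 in simp)
  have "(\<Sum>t\<le>M. q ^ t * (\<Prod>i<c + 2 * t. 1 + q ^ i) /
            (qfac (q\<^sup>2) (M - t) * qfac (q\<^sup>2) t * qfac (q\<^sup>2) (t + c))) = (\<Sum>t\<le>M. u t * e $ (M - t))"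
    by (simp add: u_def e_def mult_ac)
  also have "\<dots> = 2 / (1 + z) * (W * e) $ M"
    by (simp add: u_eq fps_mult_nth sum_distrib_left atLeast0AtMost mult.assoc)
  also have "W * e = y"
    using eF by (simp add: W_def mult.assoc mult.commute[of F])
  finally show ?thesis
    by (simp add: y_def v_def z_def mult.assoc)
qed

section \<open>Bilateral Bailey pairs\<close>

text \<open>Division by \<open>(q)\<^sub>k\<close> for \<open>k < 0\<close> gives 0, as the infinite-product definition of \<open>(q)\<^sub>k\<close> prescribes.\<close>

definition rqfac :: "complex \<Rightarrow> int \<Rightarrow> complex" where
  "rqfac q k = (if k < 0 then 0 else 1 / qfac q (nat k))"

definition bkernel :: "complex \<Rightarrow> int \<Rightarrow> int \<Rightarrow> int \<Rightarrow> complex" where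
  "bkernel q m n j = rqfac q (n - j) * rqfac q (n + j + m)"

lemma bkernel_reflect: "bkernel q m n (- m - j) = bkernel q m n j"
  by (simp add: bkernel_def algebra_simps)

lemma bkernel_eq_0: "n < j \<or> n + j + m < 0 \<Longrightarrow> bkernel q m n j = 0"
  by (auto simp: bkernel_def rqfac_def)

text \<open>When \<open>2j + m >= 0\<close>, the lower limit \<open>-(m div 2)\<close> is at most
  \<open>j\<close> and the kernel vanishes for \<open>n < j\<close>; what is left terminates in
  \<open>t = n - j\<close>.\<close>

lemma sum_bkernel_reindex:
  fixes f :: "int \<Rightarrow> complex"
  assumes "2 * j + m = int c"
  shows "(\<Sum>n=-(m div 2)..N. f n * rqfac q (N - n) * bkernel q m n j) =
    (if j \<le> N then \<Sum>t\<le>nat (N - j). f (j + int t) /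
        (qfac q (nat (N - j) - t) * qfac q t * qfac q (t + c)) else 0)"
proof -
  have L: "- (m div 2) \<le> j"
    using assms by linarith
  have "(\<Sum>n=-(m div 2)..N. f n * rqfac q (N - n) * bkernel q m n j) =
    (\<Sum>n=j..N. f n * rqfac q (N - n) * bkernel q m n j)"
    by (rule sum.mono_neutral_right) (use L in \<open>auto simp: bkernel_eq_0\<close>)
  also have "\<dots> = (\<Sum>t | int t \<le> N - j. f (j + int t) * rqfac q (N - j - int t) * bkernel q m (j + int t) j)"
    by (rule sum.reindex_bij_witness[of _ "\<lambda>t. j + int t" "\<lambda>n. nat (n - j)"]) (auto simp: algebra_simps)
  also have "\<dots> = (\<Sum>t | int t \<le> N - j. f (j + int t) /
        (qfac q (nat (N - j) - t) * qfac q t * qfac q (t + c)))"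
  proof (intro sum.cong refl)
    fix t assume t: "t \<in> {t. int t \<le> N - j}"
    have *: "j + int t + j + m = int (t + c)"
      using assms by simp
    show "f (j + int t) * rqfac q (N - j - int t) * bkernel q m (j + int t) j =
      f (j + int t) / (qfac q (nat (N - j) - t) * qfac q t * qfac q (t + c))"
      using t unfolding bkernel_def * rqfac_def by (simp add: nat_diff_distrib del: of_nat_add)
  qed
  also have "{t. int t \<le> N - j} = (if j \<le> N then {..nat (N - j)} else {})"
    by auto
  finally show ?thesis
    by auto
qed

lemma bkernel_last:
  assumes "2 * j + m = int c" "j \<le> N"
  shows "bkernel q m N j = 1 / (qfac q (nat (N - j)) * qfac q (nat (N - j) + c))"
proof -
  have "nat (N + j + m) = nat (N - j) + c" "N + j + m \<ge> 0"
    using assms by auto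
  then show ?thesis
    using assms by (simp add: bkernel_def rqfac_def)
qed

text \<open>Bailey's lemma with both parameters sent to infinity, stated for the kernel instead of
  for pairs. For \<open>2j + m >= 0\<close> it is the q-Vandermonde sum; the other \<open>j\<close>
  follow by reflection, which preserves \<open>j^2 + m j\<close>.\<close>

lemma bailey_chain_step:
  assumes q: "norm q < 1" "q \<noteq> 0"
  shows "(\<Sum>n=-(m div 2)..N. q powi (n\<^sup>2 + m * n) * rqfac q (N - n) * bkernel q m n j) =
     q powi (j\<^sup>2 + m * j) * bkernel q m N j"
proof -
  have *: "(\<Sum>n=-(m div 2)..N. q powi (n\<^sup>2 + m * n) * rqfac q (N - n) * bkernel q m n j) =
     q powi (j\<^sup>2 + m * j) * bkernel q m N j"
    if c: "2 * j + m = int c" for c j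
  proof (cases "j \<le> N")
    case True
    have "q powi ((j + int t)\<^sup>2 + m * (j + int t)) = q powi (j\<^sup>2 + m * j) * q ^ (t * t + c * t)" for t
    proof -
      have "(j + int t)\<^sup>2 + m * (j + int t) = j\<^sup>2 + m * j + int (t * t + c * t)"
        unfolding of_nat_add of_nat_mult c[symmetric] by (simp add: algebra_simps power2_eq_square)
      then show ?thesis
        using q by (metis power_int_add power_int_of_nat)
    qed
    then show ?thesis
      unfolding sum_bkernel_reindex[OF c] bkernel_last[OF c True]
      using True q_vandermonde_sum[OF q(1), of c "nat (N - j)"]
      by (simp add: sum_distrib_left [symmetric] mult.assoc times_divide_eq_right [symmetric]
          del: times_divide_eq_right)
  qed (simp add: sum_bkernel_reindex[OF c] bkernel_eq_0)
  show ?thesis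
  proof (cases "2 * j + m \<ge> 0")
    case True
    then show ?thesis
      using *[of j] zero_le_imp_eq_int by blast
  next
    case False
    then obtain c where c: "2 * (- m - j) + m = int c"
      using zero_le_imp_eq_int[of "2 * (- m - j) + m"] by auto
    have "(- m - j)\<^sup>2 + m * (- m - j) = j\<^sup>2 + m * j"
      by (simp add: power2_eq_square algebra_simps)
    with *[OF c] show ?thesis
      by (simp add: bkernel_reflect)
  qed
qed

text \<open>Reflection adds \<open>2j + m\<close> to the exponent \<open>j^2 + (m - 1) j\<close> and
  divides the bracket by \<open>q^(2j+m)\<close>, so the right-hand side is again invariant.\<close>

lemma bailey_chain_step_shifted:
  assumes q: "norm q < 1" "q \<noteq> 0"
  shows "(\<Sum>n=-(m div 2)..N. q powi (n\<^sup>2 + (m - 1) * n) * rqfac q (N - n) * bkernel q m n j) =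
     q powi (j\<^sup>2 + (m - 1) * j) * (1 + q powi (2 * j + m) - q powi (N + j + m)) * bkernel q m N j"
proof -
  have *: "(\<Sum>n=-(m div 2)..N. q powi (n\<^sup>2 + (m - 1) * n) * rqfac q (N - n) * bkernel q m n j) =
     q powi (j\<^sup>2 + (m - 1) * j) * (1 + q powi (2 * j + m) - q powi (N + j + m)) * bkernel q m N j"
    if c: "2 * j + m = int c" for c j
  proof (cases "j \<le> N")
    case True
    have e: "q powi ((j + int t)\<^sup>2 + (m - 1) * (j + int t)) =
        q powi (j\<^sup>2 + (m - 1) * j) * q ^ (t * (t - 1) + c * t)" for t
    proof -
      have "int (t * (t - 1)) = int t * int t - int t"
        by (cases t) (auto simp: algebra_simps)
      then have "(j + int t)\<^sup>2 + (m - 1) * (j + int t) = j\<^sup>2 + (m - 1) * j + int (t * (t - 1) + c * t)"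
        unfolding of_nat_add of_nat_mult[of c] c[symmetric] by (simp add: algebra_simps power2_eq_square)
      then show ?thesis
        using q by (metis power_int_add power_int_of_nat)
    qed
    have "N + j + m = int (nat (N - j) + c)"
      using True c by simp
    then have "q powi (N + j + m) = q ^ (nat (N - j) + c)"
      by (metis power_int_of_nat)
    moreover have "q powi (2 * j + m) = q ^ c"
      by (simp add: c)
    ultimately show ?thesis
      unfolding sum_bkernel_reindex[OF c] bkernel_last[OF c True] e
      using True q_vandermonde_sum_shifted[OF q(1), of c "nat (N - j)"]
      by (simp add: sum_distrib_left [symmetric] mult.assoc times_divide_eq_right [symmetric]
          del: times_divide_eq_right) simp
  qed (simp add: sum_bkernel_reindex[OF c] bkernel_eq_0)
  show ?thesis
  proof (cases "2 * j + m \<ge> 0")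
    case True
    then show ?thesis
      using *[of j] zero_le_imp_eq_int by blast
  next
    case False
    then obtain c where c: "2 * (- m - j) + m = int c"
      using zero_le_imp_eq_int[of "2 * (- m - j) + m"] by auto
    have "(- m - j)\<^sup>2 + (m - 1) * (- m - j) = j\<^sup>2 + (m - 1) * j + (2 * j + m)"
      by (simp add: power2_eq_square algebra_simps)
    then have "q powi ((- m - j)\<^sup>2 + (m - 1) * (- m - j)) *
        (1 + q powi (2 * (- m - j) + m) - q powi (N + (- m - j) + m)) =
      q powi (j\<^sup>2 + (m - 1) * j) * (q powi (2 * j + m) + q powi (2 * j + m) * q powi (2 * (- m - j) + m)
         - q powi (2 * j + m) * q powi (N + (- m - j) + m))"
      using q power_int_add[of q "j\<^sup>2 + (m - 1) * j" "2 * j + m"]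
      by (simp only: distrib_left right_diff_distrib mult_1_right mult.assoc simp_thms)
    also have "q powi (2 * j + m) * q powi (2 * (- m - j) + m) = 1"
      using q by (subst power_int_add[symmetric]) auto
    also have "q powi (2 * j + m) * q powi (N + (- m - j) + m) = q powi (N + j + m)"
      using q by (subst power_int_add[symmetric]) (auto simp: algebra_simps)
    finally show ?thesis
      using *[OF c] by (simp add: bkernel_reflect add.commute)
  qed
qed

text \<open>Half the product is \<open>(-q)_(m+2n-1)\<close>, with value \<open>1/2\<close> at
  \<open>m + 2n = 0\<close>. For \<open>2j + m = c >= 0\<close> this is the quadratic sum above;
  \<open>q^j / (1 + q^(2j+m))\<close> is invariant under reflection.\<close>

lemma bailey_base_change:
  assumes q: "norm q < 1" "q \<noteq> 0"
  shows "(\<Sum>n=-(m div 2)..N. (q powi n * (\<Prod>i<nat (m + 2 * n). 1 + q ^ i) / 2) *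
            rqfac (q\<^sup>2) (N - n) * bkernel (q\<^sup>2) m n j) =
     q powi j / (1 + q powi (2 * j + m)) * bkernel q m N j"
proof -
  have *: "(\<Sum>n=-(m div 2)..N. (q powi n * (\<Prod>i<nat (m + 2 * n). 1 + q ^ i) / 2) *
            rqfac (q\<^sup>2) (N - n) * bkernel (q\<^sup>2) m n j) =
     q powi j / (1 + q powi (2 * j + m)) * bkernel q m N j"
    if c: "2 * j + m = int c" for c j
  proof (cases "j \<le> N")
    case True
    have nat: "nat (m + 2 * (j + int t)) = c + 2 * t" for t
    proof -
      have "m + 2 * (j + int t) = int (c + 2 * t)"
        using c by simp
      then show ?thesis
        by (simp only: nat_int)
    qed
    have e: "q powi (j + int t) = q powi j * q ^ t" for t
      using q by (simp add: power_int_add)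
    have "(\<Sum>t\<le>nat (N - j). q powi (j + int t) * (\<Prod>i<nat (m + 2 * (j + int t)). 1 + q ^ i) / 2 /
        (qfac (q\<^sup>2) (nat (N - j) - t) * qfac (q\<^sup>2) t * qfac (q\<^sup>2) (t + c))) =
      q powi j / 2 * (\<Sum>t\<le>nat (N - j). q ^ t * (\<Prod>i<c + 2 * t. 1 + q ^ i) /
            (qfac (q\<^sup>2) (nat (N - j) - t) * qfac (q\<^sup>2) t * qfac (q\<^sup>2) (t + c)))"
      unfolding nat e sum_distrib_left by (intro sum.cong) auto
    also have "\<dots> = q powi j / (1 + q powi (2 * j + m)) * bkernel q m N j"
      unfolding quadratic_base_change_sum[OF q(1)] bkernel_last[OF c True] by (simp add: c)
    finally show ?thesis
      unfolding sum_bkernel_reindex[OF c] using True by simp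
  qed (simp add: sum_bkernel_reindex[OF c] bkernel_eq_0)
  show ?thesis
  proof (cases "2 * j + m \<ge> 0")
    case True
    then show ?thesis
      using *[of j] zero_le_imp_eq_int by blast
  next
    case False
    then obtain c where c: "2 * (- m - j) + m = int c"
      using zero_le_imp_eq_int[of "2 * (- m - j) + m"] by auto
    have inv: "x * inverse y / (1 + inverse y) = x / (1 + y)" if "y \<noteq> 0" for x y :: complex
    proof -
      have "1 + inverse y = (1 + y) * inverse y"
        using that by (simp add: algebra_simps)
      then show ?thesis
        using that by simp
    qed
    have "q powi (2 * (- m - j) + m) = inverse (q powi (2 * j + m))"
      by (subst power_int_minus [symmetric]) (simp add: algebra_simps)
    moreover have "q powi (- m - j) = q powi j * inverse (q powi (2 * j + m))"
    proof -
      have "- m - j = j + - (2 * j + m)"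
        by simp
      then show ?thesis
        using q by (metis power_int_add power_int_minus)
    qed
    moreover have "q powi (2 * j + m) \<noteq> 0"
      using q by simp
    ultimately have "q powi (- m - j) / (1 + q powi (2 * (- m - j) + m)) = q powi j / (1 + q powi (2 * j + m))"
      using inv[of "q powi (2 * j + m)" "q powi j"] by simp
    with *[OF c] show ?thesis
      by (simp only: bkernel_reflect)
  qed
qed

text \<open>With \<open>j = s - t\<close> this is the q-binomial theorem in base \<open>q^2\<close>
  for \<open>n = 2s + m\<close> and \<open>x = q^(2(1-s))\<close>. For \<open>s > 0\<close> the
  factor with index \<open>s - 1\<close> is zero; for \<open>s <= 0\<close> the product is a
  quotient of q-factorials.\<close>

lemma q_binomial_bilateral:
  assumes q: "norm q < 1" "q \<noteq> 0" and m: "m \<ge> 0" and s: "2 * s + m \<ge> 0"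
  shows "(\<Sum>j=-m-s..s. (-1) powi j * q powi (j\<^sup>2 - j) * bkernel (q\<^sup>2) m s j) =
     (if s \<le> 0 then (-1) powi s * q powi (s\<^sup>2 - s) *
        (qfac (q\<^sup>2) (nat (m + s)) / (qfac (q\<^sup>2) (nat (m + 2 * s)) * qfac (q\<^sup>2) (nat (- s)))) else 0)"
proof -
  have q2: "norm (q\<^sup>2) < 1"
    using q by (simp add: norm_power power_less_one_iff)
  define n where "n = nat (2 * s + m)"
  define x where "x = q powi (2 * (1 - s))"
  have n: "int n = 2 * s + m"
    using s by (simp add: n_def)
  have "(\<Sum>j=-m-s..s. (-1) powi j * q powi (j\<^sup>2 - j) * bkernel (q\<^sup>2) m s j) =
    (\<Sum>t\<le>n. (-1) powi (s - int t) * q powi ((s - int t)\<^sup>2 - (s - int t)) * bkernel (q\<^sup>2) m s (s - int t))"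
    by (rule sum.reindex_bij_witness[of _ "\<lambda>t. s - int t" "\<lambda>j. nat (s - j)"]) (use n in auto)
  also have "\<dots> = (\<Sum>t\<le>n. (-1) powi s * q powi (s\<^sup>2 - s) *
      ((-1) ^ t * (q\<^sup>2) ^ (t * (t - 1) div 2) * x ^ t / (qfac (q\<^sup>2) (n - t) * qfac (q\<^sup>2) t)))"
  proof (intro sum.cong refl)
    fix t assume t: "t \<in> {..n}"
    have 1: "(-1 :: complex) powi (s - int t) = (-1) powi s * (-1) ^ t"
      by (simp add: power_int_diff divide_inverse flip: power_inverse)
    have ev: "2 * (t * (t - 1) div 2) = t * (t - 1)"
      by (intro dvd_mult_div_cancel) auto
    have "int (t * (t - 1)) = int t * int t - int t"
      by (cases t) (auto simp: algebra_simps)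
    then have "(s - int t)\<^sup>2 - (s - int t) = (s\<^sup>2 - s) + int (t * (t - 1)) + 2 * (1 - s) * int t"
      by (simp add: algebra_simps power2_eq_square)
    then have 2: "q powi ((s - int t)\<^sup>2 - (s - int t)) = q powi (s\<^sup>2 - s) * (q\<^sup>2) ^ (t * (t - 1) div 2) * x ^ t"
      using q unfolding x_def power_mult[symmetric] ev
      by (simp only: power_int_add power_int_mult power_int_of_nat simp_thms)
    have "s + (s - int t) + m = int (n - t)"
      using t n by auto
    then have 3: "bkernel (q\<^sup>2) m s (s - int t) = 1 / (qfac (q\<^sup>2) (n - t) * qfac (q\<^sup>2) t)"
      by (simp add: bkernel_def rqfac_def)
    show "(-1) powi (s - int t) * q powi ((s - int t)\<^sup>2 - (s - int t)) * bkernel (q\<^sup>2) m s (s - int t) =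
       (-1) powi s * q powi (s\<^sup>2 - s) *
      ((-1) ^ t * (q\<^sup>2) ^ (t * (t - 1) div 2) * x ^ t / (qfac (q\<^sup>2) (n - t) * qfac (q\<^sup>2) t))"
      unfolding 1 2 3 by simp
  qed
  also have "\<dots> = (-1) powi s * q powi (s\<^sup>2 - s) * ((\<Prod>i<n. 1 - x * (q\<^sup>2) ^ i) / qfac (q\<^sup>2) n)"
    unfolding sum_distrib_left[symmetric] q_binomial_sum[OF q2] ..
  finally have main: "(\<Sum>j=-m-s..s. (-1) powi j * q powi (j\<^sup>2 - j) * bkernel (q\<^sup>2) m s j) =
    (-1) powi s * q powi (s\<^sup>2 - s) * ((\<Prod>i<n. 1 - x * (q\<^sup>2) ^ i) / qfac (q\<^sup>2) n)" .
  have x: "x * (q\<^sup>2) ^ i = q powi (2 * (1 - s + int i))" for i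
  proof -
    have "2 * (1 - s + int i) = 2 * (1 - s) + int (2 * i)"
      by simp
    then show ?thesis
      unfolding x_def power_mult[symmetric] using q by (metis power_int_add power_int_of_nat)
  qed
  show ?thesis
  proof (cases "s \<le> 0")
    case False
    have "nat (s - 1) < n"
      using False n m by linarith
    moreover have "x * (q\<^sup>2) ^ nat (s - 1) = 1"
      using False by (simp add: x)
    ultimately have "(\<Prod>i<n. 1 - x * (q\<^sup>2) ^ i) = 0"
      by (intro prod_zero) (auto intro!: bexI[of _ "nat (s - 1)"])
    then show ?thesis
      using False main by simp
  next
    case True
    then obtain a where a: "s = - int a"
      by (metis nonpos_int_cases)
    have "qfac (q\<^sup>2) a * (\<Prod>i<k. 1 - x * (q\<^sup>2) ^ i) = qfac (q\<^sup>2) (a + k)" for k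
    proof (induction k)
      case (Suc k)
      have "x * (q\<^sup>2) ^ k = (q\<^sup>2) ^ Suc (a + k)"
      proof -
        have "2 * (1 - s + int k) = int (2 * Suc (a + k))"
          by (simp add: a)
        then show ?thesis
          unfolding x unfolding power_mult[symmetric] by (metis power_int_of_nat)
      qed
      then show ?case
        using Suc by (simp add: qfac_Suc mult.assoc[symmetric])
    qed auto
    from this[of n] have "(\<Prod>i<n. 1 - x * (q\<^sup>2) ^ i) = qfac (q\<^sup>2) (a + n) / qfac (q\<^sup>2) a"
      using q2 by (simp add: field_simps)
    moreover have "int (a + n) = m + s" "int n = m + 2 * s" "int a = - s"
      using a n by auto
    then have "a + n = nat (m + s)" "n = nat (m + 2 * s)" "a = nat (- s)"
      by (metis nat_int)+
    ultimately show ?thesis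
      using True main by simp
  qed
qed

text \<open>Sign, \<open>(-q)_(m+2s-1)\<close> and q-binomial coefficient of the summand at
  \<open>s = s_r\<close>. The coefficient vanishes for \<open>s > 0\<close>, where its lower index
  exceeds the upper one.\<close>

definition bweight :: "complex \<Rightarrow> int \<Rightarrow> int \<Rightarrow> complex" where
  "bweight q m s = (if s \<le> 0 then (-1) powi s * (\<Prod>i<nat (m + 2 * s). 1 + q ^ i) / 2 *
     (qfac (q\<^sup>2) (nat (m + s)) / (qfac (q\<^sup>2) (nat (m + 2 * s)) * qfac (q\<^sup>2) (nat (- s)))) else 0)"

definition balpha :: "complex \<Rightarrow> int \<Rightarrow> int \<Rightarrow> complex" where
  "balpha q m j = (-1) powi j * q powi j\<^sup>2 / (1 + q powi (2 * j + m))"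

lemma innermost_bailey_pair:
  assumes q: "norm q < 1" "q \<noteq> 0" and m: "m \<ge> 0"
  shows "(\<Sum>n=-(m div 2)..N. rqfac (q\<^sup>2) (N - n) * (q powi n\<^sup>2 * bweight q m n)) =
     (\<Sum>j=-m-N..N. balpha q m j * bkernel q m N j)"
proof -
  have "(\<Sum>n=-(m div 2)..N. rqfac (q\<^sup>2) (N - n) * (q powi n\<^sup>2 * bweight q m n)) =
    (\<Sum>n=-(m div 2)..N. \<Sum>j=-m-N..N. (-1) powi j * q powi (j\<^sup>2 - j) *
       ((q powi n * (\<Prod>i<nat (m + 2 * n). 1 + q ^ i) / 2) *
            rqfac (q\<^sup>2) (N - n) * bkernel (q\<^sup>2) m n j))"
  proof (intro sum.cong refl)
    fix n assume n: "n \<in> {-(m div 2)..N}"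
    have n2: "2 * n + m \<ge> 0"
      using n by auto
    define R where "R = (\<Prod>i<nat (m + 2 * n). 1 + q ^ i)"
    \<comment> \<open>The exponent is shared out: \<open>q^(n^2 - n)\<close> goes to the bilateral
      q-binomial sum, \<open>q^n\<close> to the change of base.\<close>
    have "q powi n\<^sup>2 = q powi n * q powi (n\<^sup>2 - n)"
      using q by (simp flip: power_int_add)
    then have "q powi n\<^sup>2 * bweight q m n = q powi n * R / 2 *
        (\<Sum>j=-m-n..n. (-1) powi j * q powi (j\<^sup>2 - j) * bkernel (q\<^sup>2) m n j)"
      unfolding q_binomial_bilateral[OF q m n2] bweight_def R_def by simp
    \<comment> \<open>The kernel vanishes outside \<open>-m-n..n\<close>, so the range of
      \<open>j\<close> can be made independent of \<open>n\<close> before the sums are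
      swapped.\<close>
    also have "(\<Sum>j=-m-n..n. (-1) powi j * q powi (j\<^sup>2 - j) * bkernel (q\<^sup>2) m n j) =
       (\<Sum>j=-m-N..N. (-1) powi j * q powi (j\<^sup>2 - j) * bkernel (q\<^sup>2) m n j)"
      by (rule sum.mono_neutral_left) (use n in \<open>auto simp: bkernel_eq_0\<close>)
    finally show "rqfac (q\<^sup>2) (N - n) * (q powi n\<^sup>2 * bweight q m n) =
      (\<Sum>j=-m-N..N. (-1) powi j * q powi (j\<^sup>2 - j) *
       ((q powi n * (\<Prod>i<nat (m + 2 * n). 1 + q ^ i) / 2) *
            rqfac (q\<^sup>2) (N - n) * bkernel (q\<^sup>2) m n j))"
      unfolding R_def[symmetric] by (simp add: sum_distrib_left mult_ac)
  qed
  also have "\<dots> = (\<Sum>j=-m-N..N. (-1) powi j * q powi (j\<^sup>2 - j) *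
       (q powi j / (1 + q powi (2 * j + m)) * bkernel q m N j))"
    by (subst sum.swap) (simp only: sum_distrib_left [symmetric] bailey_base_change[OF q])
  also have "\<dots> = (\<Sum>j=-m-N..N. balpha q m j * bkernel q m N j)"
  proof (intro sum.cong refl)
    fix j
    have "q powi j\<^sup>2 = q powi (j\<^sup>2 - j) * q powi j"
      using q by (simp flip: power_int_add)
    then show "(-1) powi j * q powi (j\<^sup>2 - j) * (q powi j / (1 + q powi (2 * j + m)) * bkernel q m N j) =
       balpha q m j * bkernel q m N j"
      by (simp add: balpha_def)
  qed
  finally show ?thesis .
qed

section \<open>The multisum as a Bailey chain\<close>

definition chain_tuples :: "nat \<Rightarrow> nat \<Rightarrow> nat \<Rightarrow> int \<Rightarrow> (nat \<Rightarrow> int) set" where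
  "chain_tuples m r a N = {s \<in> {a..r} \<rightarrow>\<^sub>E UNIV. (\<forall>j\<in>{a..<r}. s (Suc j) \<le> s j) \<and>
      - (int m div 2) \<le> s r \<and> s a \<le> N}"

lemma chain_tuples_antimono:
  assumes "s \<in> chain_tuples m r a N" "a \<le> r"
  shows "s r \<le> s a"
  using assms(2)
proof (induction rule: inc_induct)
  case (step n)
  then have "s (Suc n) \<le> s n"
    using assms(1) by (auto simp: chain_tuples_def)
  with step show ?case
    by simp
qed auto

lemma sum_chain_tuples_last:
  "(\<Sum>s\<in>chain_tuples m r r N. f (s r)) = (\<Sum>n=-(int m div 2)..N. f n)"
  by (rule sum.reindex_bij_witness[of _ "\<lambda>n. (\<lambda>_. undefined)(r := n)" "\<lambda>s. s r"])
     (auto simp: chain_tuples_def PiE_def extensional_def fun_eq_iff)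

lemma chain_tuples_step_iff:
  assumes "a < r" "s a = undefined"
  shows "s(a := n) \<in> chain_tuples m r a N \<longleftrightarrow> n \<le> N \<and> s \<in> chain_tuples m r (Suc a) n"
proof -
  have [simp]: "{a..<r} = insert a {Suc a..<r}"
    using assms by auto
  have "s(a := n) \<in> {a..r} \<rightarrow>\<^sub>E UNIV \<longleftrightarrow> s \<in> {Suc a..r} \<rightarrow>\<^sub>E UNIV"
    using assms by (auto simp: PiE_def extensional_def le_less_Suc_eq Suc_le_eq)
  moreover have "(\<forall>j\<in>{a..<r}. (s(a := n)) (Suc j) \<le> (s(a := n)) j) \<longleftrightarrow>
     s (Suc a) \<le> n \<and> (\<forall>j\<in>{Suc a..<r}. s (Suc j) \<le> s j)"
    by auto
  ultimately show ?thesis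
    using assms unfolding chain_tuples_def by auto
qed

lemma finite_chain_tuples: "a \<le> r \<Longrightarrow> finite (chain_tuples m r a N)"
  and sum_chain_tuples_step:
  "a < r \<Longrightarrow> (\<Sum>s\<in>chain_tuples m r a N. f s) =
     (\<Sum>n=-(int m div 2)..N. \<Sum>s\<in>chain_tuples m r (Suc a) n. f (s(a := n)))"
proof -
  let ?S = "\<lambda>a N. SIGMA n:{-(int m div 2)..N}. chain_tuples m r (Suc a) n"
  \<comment> \<open>A tuple corresponds to its first entry and its tail; the tail is
    \<open>undefined\<close> at \<open>a\<close>, which makes the update invertible.\<close>
  have bij: "bij_betw (\<lambda>(n, s). s(a := n)) (?S a N) (chain_tuples m r a N)" if "a < r" for a N
  proof (rule bij_betw_byWitness[where f' = "\<lambda>s. (s a, s(a := undefined))"])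
    have undef: "s a = undefined" if "s \<in> chain_tuples m r (Suc a) n" for s n
      using that by (auto simp: chain_tuples_def PiE_def extensional_def)
    show "\<forall>x\<in>?S a N. (\<lambda>s. (s a, s(a := undefined))) ((\<lambda>(n, s). s(a := n)) x) = x"
      by (auto simp: fun_eq_iff intro!: undef[symmetric])
    show "\<forall>s\<in>chain_tuples m r a N. (\<lambda>(n, s). s(a := n)) (s a, s(a := undefined)) = s"
      by auto
    show "(\<lambda>(n, s). s(a := n)) ` ?S a N \<subseteq> chain_tuples m r a N"
      using undef chain_tuples_step_iff[OF that] by auto
    show "(\<lambda>s. (s a, s(a := undefined))) ` chain_tuples m r a N \<subseteq> ?S a N"
    proof safe
      fix s assume s: "s \<in> chain_tuples m r a N"
      then have "(s(a := undefined))(a := s a) \<in> chain_tuples m r a N"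
        by simp
      then have *: "s a \<le> N" "s(a := undefined) \<in> chain_tuples m r (Suc a) (s a)"
        using chain_tuples_step_iff[OF that, of "s(a := undefined)" "s a"] by auto
      then show "s(a := undefined) \<in> chain_tuples m r (Suc a) (s a)"
        by simp
      \<comment> \<open>The lower bound is imposed on \<open>s r\<close> only and reaches
        \<open>s a\<close> along the decreasing chain.\<close>
      have "s r \<le> s a"
        using chain_tuples_antimono[OF s] that by simp
      moreover have "- (int m div 2) \<le> s r"
        using s by (simp add: chain_tuples_def)
      ultimately show "s a \<in> {- (int m div 2)..N}"
        using * by simp
    qed
  qed
  show fin: "finite (chain_tuples m r a N)" if "a \<le> r" for a N
    using that
  proof (induction arbitrary: N rule: inc_induct)
    case base
    have "chain_tuples m r r N \<subseteq> {r..r} \<rightarrow>\<^sub>E {-(int m div 2)..N}"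
      by (auto simp: chain_tuples_def PiE_def)
    then show ?case
      by (rule finite_subset) (simp add: finite_PiE)
  next
    case (step a)
    then show ?case
      using bij_betw_finite[OF bij[OF step(2), of N]] by simp
  qed
  show "(\<Sum>s\<in>chain_tuples m r a N. f s) =
     (\<Sum>n=-(int m div 2)..N. \<Sum>s\<in>chain_tuples m r (Suc a) n. f (s(a := n)))" if "a < r"
    unfolding sum.reindex_bij_betw[OF bij[OF that], symmetric]
    using fin that by (subst sum.Sigma) (auto simp: case_prod_unfold)
qed

section \<open>The chain sum and its evaluation as a finite bilateral sum\<close>

definition link :: "complex \<Rightarrow> nat \<Rightarrow> nat \<Rightarrow> int \<Rightarrow> complex" where
  "link q r j d = (if Suc j = r then rqfac (q\<^sup>2) d else rqfac q d)"

definition chain_weight :: "complex \<Rightarrow> nat \<Rightarrow> nat \<Rightarrow> nat \<Rightarrow> nat \<Rightarrow> (nat \<Rightarrow> int) \<Rightarrow> complex" where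
  "chain_weight q m r i a s =
     (\<Prod>j\<in>{a..<r}. q powi ((s j)\<^sup>2 + (int m - (if j \<le> i then 1 else 0)) * s j) * link q r j (s j - s (Suc j)))
     * (q powi (s r)\<^sup>2 * bweight q (int m) (s r))"

text \<open>The index \<open>b\<close> is that of the variable bounding the chain from above: the sum runs over
  \<open>s\<^sub>b\<^sub>+\<^sub>1 \<ge> \<dots> \<ge> s\<^sub>r\<close> with \<open>s\<^sub>b = N\<close> prescribed.\<close>

definition chain_sum :: "complex \<Rightarrow> nat \<Rightarrow> nat \<Rightarrow> nat \<Rightarrow> nat \<Rightarrow> int \<Rightarrow> complex" where
  "chain_sum q m r i b N =
     (\<Sum>s\<in>chain_tuples m r (Suc b) N. link q r b (N - s (Suc b)) * chain_weight q m r i (Suc b) s)"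

lemma chain_sum_last:
  assumes "norm q < 1" "q \<noteq> 0" "r > 0"
  shows "chain_sum q m r i (r - 1) N =
    (\<Sum>j=-int m-N..N. balpha q (int m) j * bkernel q (int m) N j)"
proof -
  have "chain_sum q m r i (r - 1) N =
    (\<Sum>s\<in>chain_tuples m r r N. rqfac (q\<^sup>2) (N - s r) * (q powi (s r)\<^sup>2 * bweight q (int m) (s r)))"
    using assms by (simp add: chain_sum_def chain_weight_def link_def)
  also have "\<dots> = (\<Sum>n=-(int m div 2)..N. rqfac (q\<^sup>2) (N - n) * (q powi n\<^sup>2 * bweight q (int m) n))"
    by (rule sum_chain_tuples_last)
  also have "\<dots> = (\<Sum>j=-int m-N..N. balpha q (int m) j * bkernel q (int m) N j)"
    by (rule innermost_bailey_pair) (use assms in auto)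
  finally show ?thesis .
qed

lemma chain_sum_step:
  assumes "Suc b < r"
  shows "chain_sum q m r i b N = (\<Sum>n=-(int m div 2)..N.
    q powi (n\<^sup>2 + (int m - (if Suc b \<le> i then 1 else 0)) * n) * rqfac q (N - n) * chain_sum q m r i (Suc b) n)"
proof -
  let ?e = "\<lambda>j n. q powi (n\<^sup>2 + (int m - (if j \<le> i then 1 else 0)) * n)"
  have cw: "chain_weight q m r i (Suc b) (s(Suc b := n)) = ?e (Suc b) n * (link q r (Suc b) (n - s (Suc (Suc b))) *
        chain_weight q m r i (Suc (Suc b)) s)" for n s
  proof -
    have "{Suc b..<r} = insert (Suc b) {Suc (Suc b)..<r}"
      using assms by auto
    then show ?thesis
      using assms unfolding chain_weight_def by simp
  qed
  have "link q r b d = rqfac q d" for d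
    using assms by (simp add: link_def)
  then show ?thesis
    unfolding chain_sum_def sum_chain_tuples_step[OF assms] cw
    by (simp add: sum_distrib_left mult_ac)
qed

definition geo :: "nat \<Rightarrow> complex \<Rightarrow> complex" where
  "geo e y = (\<Sum>k<e. y ^ k)"

lemma geo_simps [simp]: "geo 0 y = 0" "geo (Suc e) y = geo e y + y ^ e"
  by (simp_all add: geo_def)

text \<open>Induction downwards from \<open>b = r - 1\<close>. Summing over \<open>s_(b+1)\<close>
  takes the plain chain step if that variable has no linear term, and otherwise both steps together.
  The subtraction \<open>i - b\<close> is truncated, so for \<open>b >= i\<close> the bracket is
  just \<open>1\<close>.\<close>

lemma chain_sum_eq:
  assumes q: "norm q < 1" "q \<noteq> 0" and i: "i < r" and "b < r"
  shows "chain_sum q m r i b N = (\<Sum>j=-int m-N..N. balpha q (int m) j *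
      q powi (int (r - Suc b) * (j\<^sup>2 + int m * j) - int (i - b) * j) *
      (geo (Suc (i - b)) (q powi (2 * j + int m)) - q powi (N + j + int m) * geo (i - b) (q powi (2 * j + int m)))
      * bkernel q (int m) N j)"
proof -
  have "b \<le> r - 1"
    using assms by simp
  then show ?thesis
  proof (induction arbitrary: N rule: inc_induct)
    case base
    \<comment> \<open>As \<open>i < r\<close>, the innermost variable has no linear term and the
      bracket starts as \<open>1\<close>.\<close>
    have "i - (r - 1) = 0" "r - Suc (r - 1) = 0"
      using i by auto
    then show ?case
      using chain_sum_last[OF q] i by simp
  next
    case (step b)
    have br: "Suc b < r"
      using step.hyps by auto
    have rb: "r - Suc b = Suc (r - Suc (Suc b))"
      using br by auto
    define M where "M = int m"
    define f where "f = (\<lambda>j. q powi (int (r - Suc (Suc b)) * (j\<^sup>2 + M * j) - int (i - Suc b) * j))"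
    define y where "y = (\<lambda>j. q powi (2 * j + M))"
    define e where "e = i - Suc b"
    define d :: int where "d = (if Suc b \<le> i then 1 else 0)"
    have IH: "chain_sum q m r i (Suc b) n = (\<Sum>j=-M-N..N. balpha q M j * f j *
      (geo (Suc e) (y j) - q powi (n + j + M) * geo e (y j)) * bkernel q M n j)" if "n \<le> N" for n
      unfolding step.IH M_def[symmetric] f_def y_def e_def
      by (rule sum.mono_neutral_left) (use that in \<open>auto simp: bkernel_eq_0\<close>)
    \<comment> \<open>The \<open>q^n\<close> inside the bracket cancels the linear term
      \<open>-n\<close>: the \<open>A_e\<close> part meets the plain chain step, the
      \<open>A_(e+1)\<close> part the shifted one.\<close>
    have shift: "q powi (n\<^sup>2 + (M - 1) * n) * q powi (n + j + M) = q powi (j + M) * q powi (n\<^sup>2 + M * n)" for n j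
      using q by (subst (1 2) power_int_add [symmetric]) (auto simp: algebra_simps)
    have "chain_sum q m r i b N = (\<Sum>n=-(M div 2)..N. q powi (n\<^sup>2 + (M - d) * n) * rqfac q (N - n) *
       (\<Sum>j=-M-N..N. balpha q M j * f j *
        (geo (Suc e) (y j) - q powi (n + j + M) * geo e (y j)) * bkernel q M n j))"
      unfolding chain_sum_step[OF br] M_def[symmetric] d_def by (intro sum.cong refl) (simp add: IH)
    also have "\<dots> = (\<Sum>j=-M-N..N. balpha q M j * f j * (\<Sum>n=-(M div 2)..N.
        (geo (Suc e) (y j) - q powi (n + j + M) * geo e (y j)) *
          (q powi (n\<^sup>2 + (M - d) * n) * rqfac q (N - n) * bkernel q M n j)))"
      unfolding sum_distrib_left by (subst sum.swap) (intro sum.cong refl, simp add: mult_ac)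
    also have "\<dots> = (\<Sum>j=-M-N..N. balpha q M j *
      q powi (int (r - Suc b) * (j\<^sup>2 + M * j) - int (i - b) * j) *
      (geo (Suc (i - b)) (y j) - q powi (N + j + M) * geo (i - b) (y j)) * bkernel q M N j)"
    proof (intro sum.cong refl)
      fix j
      show "balpha q M j * f j * (\<Sum>n=-(M div 2)..N.
        (geo (Suc e) (y j) - q powi (n + j + M) * geo e (y j)) *
          (q powi (n\<^sup>2 + (M - d) * n) * rqfac q (N - n) * bkernel q M n j)) =
        balpha q M j * q powi (int (r - Suc b) * (j\<^sup>2 + M * j) - int (i - b) * j) *
          (geo (Suc (i - b)) (y j) - q powi (N + j + M) * geo (i - b) (y j)) * bkernel q M N j"
      proof (cases "Suc b \<le> i")
        case True
        then have d: "d = 1" and ib: "i - b = Suc e"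
          by (auto simp: d_def e_def)
        have "(\<Sum>n=-(M div 2)..N. (geo (Suc e) (y j) - q powi (n + j + M) * geo e (y j)) *
          (q powi (n\<^sup>2 + (M - d) * n) * rqfac q (N - n) * bkernel q M n j)) =
          (\<Sum>n=-(M div 2)..N. geo (Suc e) (y j) * (q powi (n\<^sup>2 + (M - 1) * n) * rqfac q (N - n) * bkernel q M n j)
             - geo e (y j) * q powi (j + M) * (q powi (n\<^sup>2 + M * n) * rqfac q (N - n) * bkernel q M n j))"
        proof (intro sum.cong refl)
          fix n
          have ring: "(a - w * g) * (p * u * k) = a * (p * u * k) - g * (p * w) * u * k" for a w g p u k :: complex
            by (simp add: algebra_simps)
          have "(geo (Suc e) (y j) - q powi (n + j + M) * geo e (y j)) *
            (q powi (n\<^sup>2 + (M - d) * n) * rqfac q (N - n) * bkernel q M n j) =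
            geo (Suc e) (y j) * (q powi (n\<^sup>2 + (M - 1) * n) * rqfac q (N - n) * bkernel q M n j)
            - geo e (y j) * (q powi (n\<^sup>2 + (M - 1) * n) * q powi (n + j + M)) * rqfac q (N - n) * bkernel q M n j"
            unfolding d using ring by blast
          then show "(geo (Suc e) (y j) - q powi (n + j + M) * geo e (y j)) *
            (q powi (n\<^sup>2 + (M - d) * n) * rqfac q (N - n) * bkernel q M n j) =
            geo (Suc e) (y j) * (q powi (n\<^sup>2 + (M - 1) * n) * rqfac q (N - n) * bkernel q M n j)
             - geo e (y j) * q powi (j + M) * (q powi (n\<^sup>2 + M * n) * rqfac q (N - n) * bkernel q M n j)"
            unfolding shift by (simp only: mult_ac)
        qed
        also have "\<dots> = geo (Suc e) (y j) *
            (q powi (j\<^sup>2 + (M - 1) * j) * (1 + y j - q powi (N + j + M)) * bkernel q M N j)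
            - geo e (y j) * (q powi (j + M) * (q powi (j\<^sup>2 + M * j) * bkernel q M N j))"
          unfolding sum_subtractf sum_distrib_left[symmetric] bailey_chain_step[OF q]
            bailey_chain_step_shifted[OF q] y_def mult.assoc[of _ "q powi (j + M)"] ..
        also have "q powi (j + M) * (q powi (j\<^sup>2 + M * j) * bkernel q M N j) =
            q powi (j\<^sup>2 + (M - 1) * j) * y j * bkernel q M N j"
        proof -
          have "q powi (j + M) * q powi (j\<^sup>2 + M * j) = q powi (j\<^sup>2 + (M - 1) * j) * y j"
            using q unfolding y_def by (subst (1 2) power_int_add [symmetric]) (auto simp: algebra_simps)
          then show ?thesis
            by (simp only: mult.assoc [symmetric])
        qed
        \<comment> \<open>Here \<open>(1 + y) A_(e+1) - y A_e = A_(e+2)\<close>, because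
          \<open>A_(e+1) - A_e = y^e\<close>. This recurrence dictates the form of the
          bracket.\<close>
        also have "geo (Suc e) (y j) *
            (q powi (j\<^sup>2 + (M - 1) * j) * (1 + y j - q powi (N + j + M)) * bkernel q M N j)
            - geo e (y j) * (q powi (j\<^sup>2 + (M - 1) * j) * y j * bkernel q M N j) =
            q powi (j\<^sup>2 + (M - 1) * j) * (geo (Suc (Suc e)) (y j) - q powi (N + j + M) * geo (Suc e) (y j)) *
              bkernel q M N j"
          by (simp add: algebra_simps)
        also have "f j * \<dots> = q powi (int (r - Suc b) * (j\<^sup>2 + M * j) - int (i - b) * j) *
            (geo (Suc (Suc e)) (y j) - q powi (N + j + M) * geo (Suc e) (y j)) * bkernel q M N j"
        proof -
          have "f j * q powi (j\<^sup>2 + (M - 1) * j) = q powi (int (r - Suc b) * (j\<^sup>2 + M * j) - int (i - b) * j)"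
            using q unfolding f_def e_def[symmetric] ib rb
            by (subst power_int_add [symmetric]) (auto simp: algebra_simps)
          then show ?thesis
            by (simp only: mult.assoc [symmetric])
        qed
        finally show ?thesis
          unfolding ib by (simp only: mult.assoc)
      next
        case False
        then have d: "d = 0" and e0: "i - b = 0" "e = 0"
          by (auto simp: d_def e_def)
        have "f j * q powi (j\<^sup>2 + M * j) = q powi (int (r - Suc b) * (j\<^sup>2 + M * j) - int (i - b) * j)"
          using q e0 unfolding f_def e_def[symmetric] rb
          by (subst power_int_add [symmetric]) (auto simp: algebra_simps)
        then show ?thesis
          using bailey_chain_step[OF q, of M N j] unfolding d e0 by simp
      qed
    qed
    finally show ?case
      unfolding M_def y_def .
  qed
qed

section \<open>Infinite products and the Jacobi triple product\<close>

text \<open>Dominated convergence for sums: the majorant \<open>h\<close> makes the finite partial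
  sums converge uniformly in \<open>N\<close>, so the two limits may be exchanged.\<close>

lemma tannery_infsum:
  fixes f :: "nat \<Rightarrow> 'a \<Rightarrow> complex"
  assumes bound: "\<And>N x. x \<in> A \<Longrightarrow> norm (f N x) \<le> h x" and h: "h summable_on A"
    and lim: "\<And>x. x \<in> A \<Longrightarrow> (\<lambda>N. f N x) \<longlonglongrightarrow> g x"
  shows "(\<lambda>N. infsum (f N) A) \<longlonglongrightarrow> infsum g A" and "g summable_on A"
proof -
  have "norm (g x) \<le> h x" if "x \<in> A" for x
    by (rule Lim_norm_ubound[OF _ lim[OF that]]) (use bound[OF that] in auto)
  then have "(\<lambda>x. norm (g x)) summable_on A"
    using h by (intro Infinite_Sum.abs_summable_on_comparison_test'[OF h])
  then show g: "g summable_on A"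
    by (rule abs_summable_summable)
  show "(\<lambda>N. infsum (f N) A) \<longlonglongrightarrow> infsum g A"
  proof (rule swap_uniform_limit'[where S = UNIV and F = "finite_subsets_at_top A"])
    show "\<forall>\<^sub>F X in finite_subsets_at_top A. (\<lambda>N. \<Sum>x\<in>X. f N x) \<longlonglongrightarrow> (\<Sum>x\<in>X. g x)"
      by (rule eventually_finite_subsets_at_top_weakI) (auto intro!: tendsto_sum lim)
    show "(sum g \<longlongrightarrow> infsum g A) (finite_subsets_at_top A)"
      using g by (rule infsum_tendsto)
    show "uniform_limit UNIV (\<lambda>X N. \<Sum>x\<in>X. f N x) (\<lambda>N. infsum (f N) A) (finite_subsets_at_top A)"
      using Weierstrass_m_test_general[of A UNIV "\<lambda>x N. f N x" h] bound h by simp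
  qed auto
qed

section \<open>Geometric and Gaussian majorants over the integers\<close>

lemma summable_on_geometric_int:
  fixes \<rho> :: real
  assumes "0 < \<rho>" "\<rho> < 1"
  shows "(\<lambda>j::int. \<rho> ^ nat \<bar>j\<bar>) summable_on UNIV"
proof -
  have "summable (\<lambda>n. \<rho> ^ n)"
    using assms by simp
  then have s: "(\<lambda>n::nat. \<rho> ^ n) summable_on UNIV"
    using assms by (subst summable_on_UNIV_nonneg_real_iff) auto
  have "(\<lambda>j::int. \<rho> ^ nat \<bar>j\<bar>) summable_on {0..}"
    by (rule summable_on_reindex_bij_witness[of _ int nat UNIV "\<lambda>n. \<rho> ^ n", THEN iffD2]) (use s in auto)
  moreover have "(\<lambda>j::int. \<rho> ^ nat \<bar>j\<bar>) summable_on {..0}"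
    by (rule summable_on_reindex_bij_witness[of _ "\<lambda>n. - int n" "\<lambda>j. nat (- j)" UNIV "\<lambda>n. \<rho> ^ n", THEN iffD2]) (use s in auto)
  ultimately have "(\<lambda>j::int. \<rho> ^ nat \<bar>j\<bar>) summable_on ({0..} \<union> {..0})"
    by (rule summable_on_union)
  moreover have "{0..} \<union> {..0} = (UNIV :: int set)"
    by auto
  ultimately show ?thesis
    by simp
qed

lemma summable_on_gaussian_int:
  fixes \<rho> :: real and a b :: int
  assumes "0 < \<rho>" "\<rho> < 1" "a > 0"
  shows "(\<lambda>j. \<rho> powi (a * j\<^sup>2 + b * j)) summable_on UNIV"
proof -
  \<comment> \<open>Since \<open>j^2 - B |j| >= -B^2\<close>, the summand \<open>1\<close> in
    \<open>B\<close> leaves one \<open>|j|\<close> over for comparison with a geometric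
    series.\<close>
  define B where "B = \<bar>b\<bar> + 1"
  have "a * j\<^sup>2 + b * j \<ge> \<bar>j\<bar> - B\<^sup>2" for j
  proof -
    have "a * j\<^sup>2 \<ge> 1 * j\<^sup>2"
      using assms by (intro mult_right_mono) auto
    moreover have "b * j \<ge> - (\<bar>b\<bar> * \<bar>j\<bar>)"
      by (metis abs_ge_minus_self abs_mult minus_le_iff)
    moreover have "j\<^sup>2 - B * \<bar>j\<bar> \<ge> - (B\<^sup>2)"
    proof (cases "\<bar>j\<bar> \<ge> B")
      case True
      then have "\<bar>j\<bar> * \<bar>j\<bar> \<ge> B * \<bar>j\<bar>"
        by (intro mult_right_mono) auto
      moreover have "\<bar>j\<bar> * \<bar>j\<bar> = j\<^sup>2"
        by (simp add: power2_eq_square)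
      ultimately show ?thesis
        using zero_le_power2[of B] by linarith
    next
      case False
      then have "B * \<bar>j\<bar> \<le> B * B"
        by (intro mult_left_mono) (auto simp: B_def)
      then show ?thesis
        using zero_le_power2[of j] unfolding power2_eq_square by linarith
    qed
    ultimately show ?thesis
      unfolding B_def by (simp add: algebra_simps)
  qed
  then have "\<rho> powi (a * j\<^sup>2 + b * j) \<le> \<rho> powi (\<bar>j\<bar> - B\<^sup>2)" for j
    using assms by (intro power_int_decreasing) auto
  also have "\<rho> powi (\<bar>j\<bar> - B\<^sup>2) = \<rho> powi (- (B\<^sup>2)) * \<rho> ^ nat \<bar>j\<bar>" for j
    using power_int_add[of \<rho> "- (B\<^sup>2)" "\<bar>j\<bar>"] power_int_of_nat[of \<rho> "nat \<bar>j\<bar>"] assms by simp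
  finally have "\<rho> powi (a * j\<^sup>2 + b * j) \<le> \<rho> powi (- (B\<^sup>2)) * \<rho> ^ nat \<bar>j\<bar>" for j .
  moreover have "(\<lambda>j. \<rho> powi (- (B\<^sup>2)) * \<rho> ^ nat \<bar>j\<bar>) summable_on UNIV"
    by (intro summable_on_cmult_right summable_on_geometric_int assms)
  ultimately show ?thesis
    using assms by (intro summable_on_comparison_test[OF \<open>_ summable_on UNIV\<close>]) auto
qed

section \<open>Infinite q-Pochhammer symbols\<close>

lemma convergent_prod_qpoch:
  fixes x p :: complex
  assumes "norm p < 1"
  shows "convergent_prod (\<lambda>j. 1 - x * p ^ j)"
proof (rule abs_convergent_prod_imp_convergent_prod)
  have "summable (\<lambda>j. norm x * norm p ^ j)"
    using assms by (intro summable_mult summable_geometric) auto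
  then show "abs_convergent_prod (\<lambda>j. 1 - x * p ^ j)"
    by (simp add: abs_convergent_prod_conv_summable norm_mult norm_power)
qed

lemma qpoch_inf_LIMSEQ:
  assumes "norm p < 1"
  shows "(\<lambda>n. \<Prod>i<n. 1 - x * p ^ i) \<longlonglongrightarrow> qpoch_inf x p"
  using convergent_prod_LIMSEQ[OF convergent_prod_qpoch[OF assms, of x]]
  by (subst LIMSEQ_lessThan_iff_atMost) (simp add: qpoch_inf_def)

lemma qpoch_inf_split:
  assumes "norm p < 1"
  shows "qpoch_inf x p = (\<Prod>i<n. 1 - x * p ^ i) * qpoch_inf (x * p ^ n) p"
proof (rule LIMSEQ_unique)
  show "(\<lambda>k. \<Prod>i<n + k. 1 - x * p ^ i) \<longlonglongrightarrow> qpoch_inf x p"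
    using LIMSEQ_ignore_initial_segment[OF qpoch_inf_LIMSEQ[OF assms, of x], of n] by (simp add: add.commute)
  have "(\<Prod>i<n + k. 1 - x * p ^ i) = (\<Prod>i<n. 1 - x * p ^ i) * (\<Prod>i<k. 1 - x * p ^ n * p ^ i)" for k
    by (induction k) (simp_all add: power_add mult_ac)
  then show "(\<lambda>k. \<Prod>i<n + k. 1 - x * p ^ i) \<longlonglongrightarrow> (\<Prod>i<n. 1 - x * p ^ i) * qpoch_inf (x * p ^ n) p"
    using tendsto_mult[OF tendsto_const qpoch_inf_LIMSEQ[OF assms, of "x * p ^ n"]] by simp
qed

lemma qpoch_inf_nonzero:
  assumes "norm p < 1" "\<And>i. x * p ^ i \<noteq> 1"
  shows "qpoch_inf x p \<noteq> 0"
  unfolding qpoch_inf_def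
  by (rule prodinf_nonzero[OF convergent_prod_qpoch]) (use assms in \<open>auto dest: sym\<close>)

lemma qfac_altdef: "qfac q n = (\<Prod>i<n. 1 - q * q ^ i)"
  by (simp add: qfac_def)

lemma qfac_LIMSEQ: "norm q < 1 \<Longrightarrow> qfac q \<longlonglongrightarrow> qpoch_inf q q"
  using qpoch_inf_LIMSEQ[of q q] by (simp add: qfac_altdef[abs_def])

lemma qpoch_inf_self_nonzero: "norm q < 1 \<Longrightarrow> qpoch_inf q q \<noteq> 0"
  using one_minus_power_nonzero[of q "Suc _"] by (intro qpoch_inf_nonzero) auto

lemma qpoch_self:
  assumes "norm q < 1"
  shows "qpoch q q (int n) = qfac q n"
proof -
  have "qpoch_inf (q * q ^ n) q \<noteq> 0"
    using qpoch_inf_self_nonzero[OF assms] qpoch_inf_split[OF assms, of q n] by auto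
  then show ?thesis
    using qpoch_inf_split[OF assms, of q n] by (simp add: qpoch_def qfac_altdef)
qed

lemma qpoch_self_inverse:
  assumes "norm q < 1" "k \<ge> 0"
  shows "1 / qpoch q q k = rqfac q k"
  using qpoch_self[OF assms(1), of "nat k"] assms by (simp add: rqfac_def)

text \<open>Splitting one factor and then \<open>n\<close> factors off \<open>(-1)_inf\<close> gives
  two expressions for it. The first, \<open>2 (-q)_inf\<close>, is the source of the
  \<open>1/2\<close>, also at \<open>k = 0\<close>.\<close>

lemma qpoch_neg:
  assumes "norm q < 1" "q \<noteq> 0" "k \<ge> 0"
  shows "qpoch (- q) q (k - 1) = (\<Prod>i<nat k. 1 + q ^ i) / 2"
proof -
  define n where "n = nat k"
  have k: "k = int n"
    using assms by (simp add: n_def)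
  have nz: "qpoch_inf (- (q ^ n)) q \<noteq> 0"
  proof (rule qpoch_inf_nonzero[OF assms(1)])
    fix i
    show "- (q ^ n) * q ^ i \<noteq> 1"
    proof
      assume "- (q ^ n) * q ^ i = 1"
      then have "q ^ (n + i) = - 1"
        by (metis minus_minus mult_minus_left power_add)
      then show False
        using one_plus_power_nonzero[OF assms(1), of "n + i"] by simp
    qed
  qed
  have "- q * q powi (k - 1) = - (q ^ n)"
    using assms by (simp add: k power_int_diff)
  moreover have "2 * qpoch_inf (- q) q = (\<Prod>i<n. 1 + q ^ i) * qpoch_inf (- (q ^ n)) q"
    using qpoch_inf_split[OF assms(1), of "-1" 1] qpoch_inf_split[OF assms(1), of "-1" n] by simp
  ultimately show ?thesis
    unfolding qpoch_def n_def[symmetric] using nz by (simp add: field_simps)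
qed

lemma rqfac_LIMSEQ:
  assumes "norm q < 1"
  shows "(\<lambda>N. rqfac q (int N + k)) \<longlonglongrightarrow> 1 / qpoch_inf q q"
proof -
  have lim: "(\<lambda>n. 1 / qfac q n) \<longlonglongrightarrow> 1 / qpoch_inf q q"
    using assms by (intro tendsto_divide tendsto_const qfac_LIMSEQ qpoch_inf_self_nonzero)
  have "filterlim (\<lambda>N. nat (int N + k)) at_top sequentially"
    unfolding filterlim_at_top eventually_sequentially
  proof
    fix Z
    show "\<exists>N. \<forall>n\<ge>N. Z \<le> nat (int n + k)"
      by (rule exI[of _ "Z + nat \<bar>k\<bar>"]) auto
  qed
  from filterlim_compose[OF lim this]
  have "(\<lambda>N. 1 / qfac q (nat (int N + k))) \<longlonglongrightarrow> 1 / qpoch_inf q q" .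
  moreover have "\<forall>\<^sub>F N in sequentially. 1 / qfac q (nat (int N + k)) = rqfac q (int N + k)"
    using eventually_ge_at_top[of "nat \<bar>k\<bar>"] by eventually_elim (auto simp: rqfac_def)
  ultimately show ?thesis
    by (rule Lim_transform_eventually)
qed

lemma rqfac_bounded:
  assumes "norm q < 1"
  obtains C where "C \<ge> 1" "\<And>k. norm (rqfac q k) \<le> C"
proof -
  have "(\<lambda>n. 1 / qfac q n) \<longlonglongrightarrow> 1 / qpoch_inf q q"
    using assms by (intro tendsto_divide tendsto_const qfac_LIMSEQ qpoch_inf_self_nonzero)
  then have "Bseq (\<lambda>n. 1 / qfac q n)"
    using convergent_def convergent_imp_Bseq by blast
  then obtain K where K: "\<And>n. norm (1 / qfac q n) \<le> K"
    by (auto simp: Bseq_def)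
  have "norm (rqfac q k) \<le> max 1 K" for k
    using K[of "nat k"] by (auto simp: rqfac_def)
  then show ?thesis
    by (intro that[of "max 1 K"]) auto
qed

section \<open>The Jacobi triple product\<close>

lemma powi_mult_power: "x \<noteq> 0 \<Longrightarrow> x powi k * x ^ n = x powi (k + int n)" for x :: complex
  by (simp add: power_int_add)

text \<open>The upper half of the \<open>2N\<close> factors is already in place. In the lower half
  the powers of \<open>w\<close> are negative; after reversal each factor is inverted by
  \<open>1 - u = -u (1 - 1/u)\<close>, and the extracted \<open>-u\<close> make up the
  prefactor.\<close>

lemma prod_shifted_theta:
  fixes w z :: complex
  assumes "w \<noteq> 0" "z \<noteq> 0"
  shows "(\<Prod>i<2 * N. 1 - z * w powi (- 2 * int N) * (w\<^sup>2) ^ i) =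
     (-1) ^ N * z ^ N * w powi (- int (N * N + N)) *
     ((\<Prod>i<N. 1 - z * (w\<^sup>2) ^ i) * (\<Prod>i<N. 1 - w\<^sup>2 / z * (w\<^sup>2) ^ i))"
proof -
  have "(\<Prod>i<N + k. 1 - z * w powi (- 2 * int N) * (w\<^sup>2) ^ i) =
    (\<Prod>i<N. 1 - z * w powi (- 2 * int N) * (w\<^sup>2) ^ i) * (\<Prod>i<k. 1 - z * (w\<^sup>2) ^ i)" for k
  proof (induction k)
    case (Suc k)
    have "w powi (- 2 * int N) * (w\<^sup>2) ^ (N + k) = (w\<^sup>2) ^ k"
      using assms by (simp add: power_add power_int_minus power_int_mult flip: power_mult)
    then show ?case
      using Suc by (simp add: mult.assoc)
  qed auto
  from this[of N] have split: "(\<Prod>i<2 * N. 1 - z * w powi (- 2 * int N) * (w\<^sup>2) ^ i) =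
    (\<Prod>i<N. 1 - z * w powi (- 2 * int N) * (w\<^sup>2) ^ i) * (\<Prod>i<N. 1 - z * (w\<^sup>2) ^ i)"
    by (simp only: mult_2 [of N, symmetric])
  have "(\<Prod>i<N. 1 - z * w powi (- 2 * int N) * (w\<^sup>2) ^ i) =
     (\<Prod>i<N. 1 - z * w powi (- 2 * int (Suc (N - Suc i))))"
  proof (intro prod.cong refl)
    fix i assume i: "i \<in> {..<N}"
    have "- 2 * int N + int (2 * i) = - 2 * int (Suc (N - Suc i))"
      using i by auto
    then have "w powi (- 2 * int N) * w ^ (2 * i) = w powi (- 2 * int (Suc (N - Suc i)))"
      using assms(1) by (simp only: powi_mult_power simp_thms)
    then show "1 - z * w powi (- 2 * int N) * (w\<^sup>2) ^ i = 1 - z * w powi (- 2 * int (Suc (N - Suc i)))"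
      by (simp only: power_mult [of w 2, symmetric] mult.assoc)
  qed
  also have "\<dots> = (\<Prod>i<N. 1 - z * w powi (- 2 * int (Suc i)))"
    by (rule prod.nat_diff_reindex)
  also have "\<dots> = (-1) ^ N * z ^ N * w powi (- int (N * N + N)) * (\<Prod>i<N. 1 - w\<^sup>2 / z * (w\<^sup>2) ^ i)"
  proof (induction N)
    case (Suc N)
    define P where "P = w powi (- 2 * int (Suc N))"
    have "w\<^sup>2 * (w\<^sup>2) ^ N = w ^ (2 * Suc N)"
      by (simp only: power_mult power_Suc)
    then have "P * (w\<^sup>2 * (w\<^sup>2) ^ N) = w powi (- 2 * int (Suc N) + int (2 * Suc N))"
      unfolding P_def using powi_mult_power[OF assms(1), of "- 2 * int (Suc N)" "2 * Suc N"] by argo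
    also have "\<dots> = 1"
      by simp
    finally have "z * P * (w\<^sup>2 / z * (w\<^sup>2) ^ N) = 1"
      using assms(2) by (simp add: mult_ac)
    then have 1: "1 - z * P = (-1) * z * P * (1 - w\<^sup>2 / z * (w\<^sup>2) ^ N)"
      by (simp only: right_diff_distrib mult_1_right mult.assoc mult_minus_left mult_1_left) simp
    have "w powi (- int (Suc N * Suc N + Suc N)) = w powi (- int (N * N + N)) * w powi (- 2 * int (Suc N))"
      using assms by (subst power_int_add [symmetric]) (auto simp: algebra_simps)
    then show ?case
      unfolding prod.lessThan_Suc Suc P_def[symmetric] 1 power_Suc by (simp only: mult_ac)
  qed auto
  finally show ?thesis
    unfolding split by (simp only: mult_ac)
qed

text \<open>The q-binomial theorem in base \<open>w^2\<close> with \<open>2N\<close> factors and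
  \<open>x = z w^(-2N)\<close>, recentred by \<open>t = j + N\<close>. Recentring the sum and
  inverting half of the product yield the same constant \<open>c\<close>, which cancels.\<close>

lemma finite_jacobi_triple_product:
  fixes w z :: complex
  assumes w: "w \<noteq> 0" "norm w < 1" and z: "z \<noteq> 0"
  shows "(\<Sum>j=-int N..int N. (-1) powi j * w powi (j\<^sup>2 - j) * z powi j *
            (rqfac (w\<^sup>2) (int N - j) * rqfac (w\<^sup>2) (int N + j))) =
     (\<Prod>i<N. 1 - z * (w\<^sup>2) ^ i) * (\<Prod>i<N. 1 - w\<^sup>2 / z * (w\<^sup>2) ^ i) / qfac (w\<^sup>2) (2 * N)"
proof -
  have w2: "norm (w\<^sup>2) < 1"
    using w by (simp add: norm_power power_less_one_iff)
  define c where "c = (-1) ^ N * z ^ N * w powi (- int (N * N + N))"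
  define x where "x = z * w powi (- 2 * int N)"
  have "c \<noteq> 0"
    using assms by (simp add: c_def)
  have "c * (\<Sum>j=-int N..int N. (-1) powi j * w powi (j\<^sup>2 - j) * z powi j *
            (rqfac (w\<^sup>2) (int N - j) * rqfac (w\<^sup>2) (int N + j))) =
     (\<Sum>t\<le>2 * N. (-1) ^ t * (w\<^sup>2) ^ (t * (t - 1) div 2) * x ^ t / (qfac (w\<^sup>2) (2 * N - t) * qfac (w\<^sup>2) t))"
    unfolding sum_distrib_left
  proof (rule sum.reindex_bij_witness[of _ "\<lambda>t. int t - int N" "\<lambda>j. nat (j + int N)"])
    fix j assume j: "j \<in> {- int N..int N}"
    define t where "t = nat (j + int N)"
    have t: "j = int t - int N" "t \<le> 2 * N"
      using j by (auto simp: t_def)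
    have 1: "(-1 :: complex) ^ t = (-1) ^ N * (-1) powi j"
      unfolding t by (simp add: power_int_diff)
    have 2: "z ^ t = z ^ N * z powi j"
      unfolding t using z by (simp add: power_int_diff)
    have ev: "2 * (t * (t - 1) div 2) = t * (t - 1)"
      by (intro dvd_mult_div_cancel) auto
    have "int (t * (t - 1)) = int t * int t - int t"
      by (cases t) (auto simp: algebra_simps)
    then have e: "int (t * (t - 1)) + - 2 * int N * int t = - int (N * N + N) + (j\<^sup>2 - j)"
      unfolding t by (simp add: algebra_simps power2_eq_square)
    have 3: "w ^ (t * (t - 1)) * (w powi (- 2 * int N)) ^ t = w powi (- int (N * N + N)) * w powi (j\<^sup>2 - j)"
    proof -
      have "(w powi (- 2 * int N)) ^ t = w powi (- 2 * int N * int t)"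
        by (simp only: power_int_mult power_int_of_nat)
      then have "w ^ (t * (t - 1)) * (w powi (- 2 * int N)) ^ t = w powi (- 2 * int N * int t) * w ^ (t * (t - 1))"
        by (simp only: mult.commute)
      also have "\<dots> = w powi (- int (N * N + N) + (j\<^sup>2 - j))"
        unfolding powi_mult_power[OF w(1)] e[symmetric] by (simp only: add.commute)
      finally show ?thesis
        using w(1) power_int_add[of w "- int (N * N + N)" "j\<^sup>2 - j"] by argo
    qed
    have "(-1) ^ t * (w\<^sup>2) ^ (t * (t - 1) div 2) * x ^ t = c * ((-1) powi j * w powi (j\<^sup>2 - j) * z powi j)"
    proof -
      have "(-1) ^ t * (w\<^sup>2) ^ (t * (t - 1) div 2) * x ^ t =
          (-1) ^ t * z ^ t * (w ^ (t * (t - 1)) * (w powi (- 2 * int N)) ^ t)"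
        unfolding x_def power_mult_distrib power_mult[of w 2, symmetric] ev by (simp only: mult_ac)
      then show ?thesis
        unfolding 1 2 3 c_def by (simp only: mult_ac)
    qed
    moreover have "int N - j = int (2 * N - t)" "int N + j = int t"
      using t by auto
    ultimately show "(-1) ^ nat (j + int N) * (w\<^sup>2) ^ (nat (j + int N) * (nat (j + int N) - 1) div 2) * x ^ nat (j + int N) /
        (qfac (w\<^sup>2) (2 * N - nat (j + int N)) * qfac (w\<^sup>2) (nat (j + int N))) =
        c * ((-1) powi j * w powi (j\<^sup>2 - j) * z powi j * (rqfac (w\<^sup>2) (int N - j) * rqfac (w\<^sup>2) (int N + j)))"
      unfolding t_def[symmetric] rqfac_def by (simp del: of_nat_diff)
  qed auto
  also have "\<dots> = c * ((\<Prod>i<N. 1 - z * (w\<^sup>2) ^ i) * (\<Prod>i<N. 1 - w\<^sup>2 / z * (w\<^sup>2) ^ i) / qfac (w\<^sup>2) (2 * N))"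
    unfolding q_binomial_sum[OF w2] x_def prod_shifted_theta[OF w(1) z] c_def by simp
  finally show ?thesis
    unfolding mult_left_cancel[OF \<open>c \<noteq> 0\<close>] .
qed

text \<open>The limit of the finite form for \<open>w = q^r\<close>, base \<open>p = q^(2r)\<close>.
  The kernel contributes \<open>1 / (p)_inf^2\<close> on one side and \<open>1 / (p)_inf\<close>
  stands on the other, which leaves \<open>(p)_inf\<close> as the third product.\<close>

lemma jacobi_triple_product:
  fixes q :: complex
  assumes q: "q \<noteq> 0" "norm q < 1" and r: "r > 0"
  shows "((\<lambda>j. (-1) powi j * q powi (int r * (j\<^sup>2 - j) + A * j)) has_sum
     qpoch_infs [q ^ (2 * r), q powi A, q powi (2 * int r - A)] (q ^ (2 * r))) UNIV"
proof -
  define w where "w = q ^ r"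
  define z where "z = q powi A"
  define p where "p = q ^ (2 * r)"
  have wp: "w\<^sup>2 = p"
    by (simp add: w_def p_def mult.commute flip: power_mult)
  have w: "w \<noteq> 0" "norm w < 1"
    using q r by (auto simp: w_def norm_power power_less_one_iff)
  have p: "norm p < 1"
    using q r by (auto simp: p_def norm_power power_less_one_iff)
  have z: "z \<noteq> 0"
    using q by (simp add: z_def)
  have pz: "q powi (2 * int r - A) = p / z"
    using q unfolding p_def z_def by (simp add: power_int_diff power_int_mult flip: power_mult)
  define g where "g = (\<lambda>j. (-1) powi j * q powi (int r * (j\<^sup>2 - j) + A * j))"
  have g: "g j = (-1) powi j * w powi (j\<^sup>2 - j) * z powi j" for j
    using q unfolding g_def w_def z_def by (simp add: power_int_add power_int_mult)
  obtain C where C: "C \<ge> 1" "\<And>k. norm (rqfac p k) \<le> C"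
    using rqfac_bounded[OF p] by blast
  define f where "f = (\<lambda>N j. g j * (rqfac p (int N - j) * rqfac p (int N + j)))"
  have norm_g: "norm (g j) = norm q powi (int r * j\<^sup>2 + (A - int r) * j)" for j
    unfolding g_def by (simp add: norm_mult norm_power_int algebra_simps)
  have "(\<lambda>j. norm (g j)) summable_on UNIV"
    unfolding norm_g using q r by (intro summable_on_gaussian_int) auto
  then have h: "(\<lambda>j. norm (g j) * C\<^sup>2) summable_on UNIV"
    by (intro summable_on_cmult_left)
  have bound: "norm (f N j) \<le> norm (g j) * C\<^sup>2" for N j
    unfolding f_def norm_mult power2_eq_square
    using C by (intro mult_left_mono mult_mono) (auto intro: order_trans[of 0 1 C])
  have lim: "(\<lambda>N. f N j) \<longlonglongrightarrow> g j * (1 / qpoch_inf p p * (1 / qpoch_inf p p))" for j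
    unfolding f_def using rqfac_LIMSEQ[OF p, of j] rqfac_LIMSEQ[OF p, of "-j"]
    by (intro tendsto_intros) auto
  have L1: "(\<lambda>N. infsum (f N) UNIV) \<longlonglongrightarrow> infsum (\<lambda>j. g j * (1 / qpoch_inf p p * (1 / qpoch_inf p p))) UNIV"
    using bound by (intro tannery_infsum(1)[OF _ h lim])
  have fin: "infsum (f N) UNIV = (\<Prod>i<N. 1 - z * p ^ i) * (\<Prod>i<N. 1 - p / z * p ^ i) / qfac p (2 * N)" for N
  proof -
    have "infsum (f N) UNIV = infsum (f N) {-int N..int N}"
      by (rule infsum_cong_neutral) (auto simp: f_def rqfac_def)
    also have "\<dots> = (\<Sum>j=-int N..int N. f N j)"
      by simp
    also have "\<dots> = (\<Prod>i<N. 1 - z * p ^ i) * (\<Prod>i<N. 1 - p / z * p ^ i) / qfac p (2 * N)"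
      unfolding f_def g using finite_jacobi_triple_product[OF w z, of N] unfolding wp .
    finally show ?thesis .
  qed
  have L2: "(\<lambda>N. (\<Prod>i<N. 1 - z * p ^ i) * (\<Prod>i<N. 1 - p / z * p ^ i) / qfac p (2 * N)) \<longlonglongrightarrow>
     qpoch_inf z p * qpoch_inf (p / z) p / qpoch_inf p p"
  proof (intro tendsto_divide tendsto_mult qpoch_inf_LIMSEQ p qpoch_inf_self_nonzero)
    show "(\<lambda>N. qfac p (2 * N)) \<longlonglongrightarrow> qpoch_inf p p"
      using LIMSEQ_subseq_LIMSEQ[OF qfac_LIMSEQ[OF p], of "\<lambda>N. 2 * N"]
      by (auto simp: strict_mono_def o_def)
  qed
  have "infsum (\<lambda>j. g j * (1 / qpoch_inf p p * (1 / qpoch_inf p p))) UNIV =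
    qpoch_inf z p * qpoch_inf (p / z) p / qpoch_inf p p"
    using LIMSEQ_unique[OF L1[unfolded fin] L2] .
  then have "infsum g UNIV * (1 / qpoch_inf p p * (1 / qpoch_inf p p)) =
    qpoch_inf z p * qpoch_inf (p / z) p / qpoch_inf p p"
    unfolding infsum_cmult_left' .
  then have "infsum g UNIV = qpoch_inf p p * (qpoch_inf z p * qpoch_inf (p / z) p)"
    using qpoch_inf_self_nonzero[OF p] by (simp add: field_simps)
  moreover have "g summable_on UNIV"
    using \<open>(\<lambda>j. norm (g j)) summable_on UNIV\<close> by (rule abs_summable_summable)
  ultimately show ?thesis
    unfolding g_def[symmetric] p_def[symmetric] z_def[symmetric] pz
    by (simp add: has_sum_iff qpoch_infs_def)
qed

section \<open>Passage to the limit\<close>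

lemma has_sum_finite_sum:
  fixes f :: "'b \<Rightarrow> 'a \<Rightarrow> 'c::topological_comm_monoid_add"
  assumes "finite I" "\<And>k. k \<in> I \<Longrightarrow> (f k has_sum s k) A"
  shows "((\<lambda>x. \<Sum>k\<in>I. f k x) has_sum (\<Sum>k\<in>I. s k)) A"
  using assms by (induction I rule: finite_induct) (auto intro!: has_sum_add)

text \<open>Supplies the majorant of the multisum. A function on \<open>insert x F\<close> is a
  value at \<open>x\<close> with a function on \<open>F\<close>, and for nonnegative terms iterated
  summability gives joint summability.\<close>

lemma summable_on_prod_PiE:
  fixes f :: "'a \<Rightarrow> 'b \<Rightarrow> real"
  assumes "finite A" "\<And>x. x \<in> A \<Longrightarrow> f x summable_on UNIV" "\<And>x y. f x y \<ge> 0"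
  shows "(\<lambda>g. \<Prod>x\<in>A. f x (g x)) summable_on (A \<rightarrow>\<^sub>E UNIV)"
  using assms(1,2)
proof (induction A rule: finite_induct)
  case (insert x F)
  define T where "T = (UNIV :: 'b set) \<times> (F \<rightarrow>\<^sub>E (UNIV :: 'b set))"
  define P where "P = (\<lambda>g. \<Prod>x\<in>F. f x (g x))"
  have inj: "inj_on (\<lambda>(y, g). g(x := y)) T"
    unfolding T_def using inj_combinator[of x F "\<lambda>_. UNIV"] insert.hyps by simp
  have P: "P summable_on (F \<rightarrow>\<^sub>E UNIV)"
    unfolding P_def using insert by simp
  have "(\<lambda>(y, g). f x y * P g) summable_on T"
    unfolding T_def
  proof (rule summable_on_SigmaI)
    show "((\<lambda>g. (case (y, g) of (y, g) \<Rightarrow> f x y * P g)) has_sum f x y * infsum P (F \<rightarrow>\<^sub>E UNIV)) (F \<rightarrow>\<^sub>E UNIV)" for y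
      using P by (auto intro!: has_sum_cmult_right)
    show "(\<lambda>y. f x y * infsum P (F \<rightarrow>\<^sub>E UNIV)) summable_on UNIV"
      using insert.prems by (intro summable_on_cmult_left) auto
  qed (auto simp: P_def intro!: mult_nonneg_nonneg prod_nonneg assms(3))
  also have "?this \<longleftrightarrow> ((\<lambda>g. \<Prod>x\<in>insert x F. f x (g x)) \<circ> (\<lambda>(y, g). g(x := y))) summable_on T"
  proof (rule summable_on_cong)
    fix p assume "p \<in> T"
    obtain y g where p: "p = (y, g)"
      by (cases p)
    have "(\<Prod>z\<in>F. f z ((g(x := y)) z)) = P g"
      unfolding P_def by (rule prod.cong) (use insert.hyps in auto)
    then show "(case p of (y, g) \<Rightarrow> f x y * P g) =
        ((\<lambda>g. \<Prod>x\<in>insert x F. f x (g x)) \<circ> (\<lambda>(y, g). g(x := y))) p"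
      using insert.hyps by (simp add: p)
  qed
  also have "\<dots> \<longleftrightarrow> (\<lambda>g. \<Prod>x\<in>insert x F. f x (g x)) summable_on (\<lambda>(y, g). g(x := y)) ` T"
    by (rule summable_on_reindex [OF inj, symmetric])
  finally show ?case
    unfolding PiE_insert_eq T_def by simp
qed auto

section \<open>The multisum as a limit of chain sums\<close>

lemma power_int_sum:
  fixes x :: complex
  assumes "x \<noteq> 0"
  shows "x powi (\<Sum>j\<in>A. f j) = (\<Prod>j\<in>A. x powi f j)"
  using assms by (induction A rule: infinite_finite_induct) (auto simp: power_int_add)

lemma floor_half_nat: "\<lfloor>real m / 2\<rfloor> = int m div 2"
  using floor_divide_of_int_eq[of "int m" 2] by simp

lemma chain_tuples_index_tuples: "chain_tuples m r 1 N = {s \<in> index_tuples m r. s 1 \<le> N}"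
  unfolding chain_tuples_def index_tuples_def floor_half_nat by auto

lemma summand_eq_chain_weight:
  fixes q :: complex
  assumes q: "q \<noteq> 0" "norm q < 1" and r: "r \<ge> 2" and i: "i \<le> r - 1" and s: "s \<in> index_tuples m r"
  shows "q powi ((\<Sum>j=1..r. (s j)\<^sup>2) + int m * (\<Sum>j=1..r-1. s j) - (\<Sum>j=1..i. s j))
             * qpoch (- q) q (int m + 2 * s r - 1)
             / ((\<Prod>j=1..r-2. qpoch q q (s j - s (Suc j)))
                * qpoch (q\<^sup>2) (q\<^sup>2) (s (r - 1) - s r))
             * (-1) powi (s r)
             * qbinom (q\<^sup>2) (int m + s r) (int m + 2 * s r) = chain_weight q m r i 1 s"
proof -
  have q2: "norm (q\<^sup>2) < 1"
    using q by (simp add: norm_power power_less_one_iff)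
  have mono: "s (Suc j) \<le> s j" if "j \<in> {1..<r}" for j
    using s that by (auto simp: index_tuples_def)
  have sr: "int m + 2 * s r \<ge> 0"
    using s by (auto simp: index_tuples_def floor_half_nat)
  have I: "{1..r} = insert r {1..<r}" "{1..r-1} = {1..<r}" "{1..<r} = insert (r - 1) {1..r-2}"
    using r by auto
  \<comment> \<open>As \<open>i <= r - 1\<close>, the linear terms can be spread over
    \<open>s_1, ..., s_(r-1)\<close> by an indicator and never reach \<open>s_r\<close>.\<close>
  have "(\<Sum>j=1..i. s j) = (\<Sum>j=1..<r. (if j \<le> i then 1 else 0) * s j)"
    by (rule sum.mono_neutral_cong_left) (use i r in auto)
  then have "(\<Sum>j=1..r. (s j)\<^sup>2) + int m * (\<Sum>j=1..r-1. s j) - (\<Sum>j=1..i. s j) =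
     (s r)\<^sup>2 + (\<Sum>j=1..<r. (s j)\<^sup>2 + (int m - (if j \<le> i then 1 else 0)) * s j)"
    unfolding I(1,2) by (simp add: sum_distrib_left sum.distrib sum_subtractf left_diff_distrib)
  then have pw: "q powi ((\<Sum>j=1..r. (s j)\<^sup>2) + int m * (\<Sum>j=1..r-1. s j) - (\<Sum>j=1..i. s j)) =
     q powi (s r)\<^sup>2 * (\<Prod>j=1..<r. q powi ((s j)\<^sup>2 + (int m - (if j \<le> i then 1 else 0)) * s j))"
    using q by (simp add: power_int_add power_int_sum)
  have "(\<Prod>j=1..<r. link q r j (s j - s (Suc j))) =
     (\<Prod>j=1..r-2. rqfac q (s j - s (Suc j))) * rqfac (q\<^sup>2) (s (r - 1) - s r)"
  proof -
    have "(\<Prod>j=1..r-2. link q r j (s j - s (Suc j))) = (\<Prod>j=1..r-2. rqfac q (s j - s (Suc j)))"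
      by (rule prod.cong) (use r in \<open>auto simp: link_def\<close>)
    moreover have "Suc (r - 1) = r" "r - 1 \<notin> {1..r-2}"
      using r by auto
    ultimately show ?thesis
      unfolding I(3) by (simp add: link_def mult.commute)
  qed
  also have "(\<Prod>j=1..r-2. rqfac q (s j - s (Suc j))) = (\<Prod>j=1..r-2. 1 / qpoch q q (s j - s (Suc j)))"
  proof (rule prod.cong [OF refl])
    fix j assume "j \<in> {1..r-2}"
    then have "s (Suc j) \<le> s j"
      using r by (intro mono) auto
    then show "rqfac q (s j - s (Suc j)) = 1 / qpoch q q (s j - s (Suc j))"
      using qpoch_self_inverse[OF q(2)] by simp
  qed
  also have "\<dots> = 1 / (\<Prod>j=1..r-2. qpoch q q (s j - s (Suc j)))"
    by (simp add: prod_dividef)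
  also have "rqfac (q\<^sup>2) (s (r - 1) - s r) = 1 / qpoch (q\<^sup>2) (q\<^sup>2) (s (r - 1) - s r)"
  proof -
    have "s r \<le> s (r - 1)"
      using mono[of "r - 1"] r by simp
    then show ?thesis
      using qpoch_self_inverse[OF q2] by simp
  qed
  finally have links: "(\<Prod>j=1..<r. link q r j (s j - s (Suc j))) =
     1 / ((\<Prod>j=1..r-2. qpoch q q (s j - s (Suc j))) * qpoch (q\<^sup>2) (q\<^sup>2) (s (r - 1) - s r))"
    by simp
  have "qpoch (- q) q (int m + 2 * s r - 1) * (-1) powi (s r) * qbinom (q\<^sup>2) (int m + s r) (int m + 2 * s r)
     = bweight q (int m) (s r)"
  proof (cases "s r \<le> 0")
    case True
    have fac: "qpoch (q\<^sup>2) (q\<^sup>2) k = qfac (q\<^sup>2) (nat k)" if "k \<ge> 0" for k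
      using qpoch_self[OF q2, of "nat k"] that by simp
    have "qbinom (q\<^sup>2) (int m + s r) (int m + 2 * s r) =
      qfac (q\<^sup>2) (nat (int m + s r)) / (qfac (q\<^sup>2) (nat (int m + 2 * s r)) * qfac (q\<^sup>2) (nat (- s r)))"
      using True sr by (simp add: qbinom_def fac)
    then show ?thesis
      unfolding qpoch_neg[OF q(2) q(1) sr] using True by (simp add: bweight_def)
  next
    case False
    then show ?thesis
      by (simp add: bweight_def qbinom_def)
  qed
  then show ?thesis
    unfolding chain_weight_def prod.distrib links pw by (simp add: mult_ac)
qed

text \<open>The ordering of the variables is given up. Links are bounded, and \<open>bweight\<close>
  has only finitely many nonzero values in the range of \<open>s_r\<close>, so a product of
  independent Gaussians dominates the summand.\<close>

lemma chain_weight_summable: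
  fixes q :: complex
  assumes q: "q \<noteq> 0" "norm q < 1" and r: "r \<ge> 2"
  shows "(\<lambda>s. norm (chain_weight q m r i 1 s)) summable_on index_tuples m r"
proof -
  have q2: "norm (q\<^sup>2) < 1"
    using q by (simp add: norm_power power_less_one_iff)
  obtain C1 where C1: "C1 \<ge> 1" "\<And>k. norm (rqfac q k) \<le> C1"
    using rqfac_bounded[OF q(2)] by blast
  obtain C2 where C2: "C2 \<ge> 1" "\<And>k. norm (rqfac (q\<^sup>2) k) \<le> C2"
    using rqfac_bounded[OF q2] by blast
  define C where "C = max C1 C2"
  have C: "norm (link q r j d) \<le> C" "C \<ge> 0" for j d
    using C1(1) C2(1) C1(2)[of d] C2(2)[of d] by (auto simp: link_def C_def)
  define B where "B = (\<Sum>k=-(int m div 2)..0. norm (bweight q (int m) k))"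
  have B: "norm (bweight q (int m) k) \<le> B" if "- (int m div 2) \<le> k" for k
  proof (cases "k \<le> 0")
    case True
    then show ?thesis
      unfolding B_def using that by (intro member_le_sum) auto
  next
    case False
    then show ?thesis
      unfolding B_def by (simp add: bweight_def sum_nonneg)
  qed
  define b where "b = (\<lambda>j. if j = r then 0 else int m - (if j \<le> i then 1 else 0))"
  define f where "f = (\<lambda>j n. norm q powi (1 * n\<^sup>2 + b j * n))"
  have f_nonneg: "f j n \<ge> 0" for j n
    by (simp add: f_def)
  have "(\<lambda>s. \<Prod>j=1..r. f j (s j)) summable_on ({1..r} \<rightarrow>\<^sub>E UNIV)"
    unfolding f_def using q by (intro summable_on_prod_PiE summable_on_gaussian_int) auto
  then have "(\<lambda>s. \<Prod>j=1..r. f j (s j)) summable_on index_tuples m r"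
    by (rule summable_on_subset) (auto simp: index_tuples_def)
  then have "(\<lambda>s. C ^ (r - 1) * B * (\<Prod>j=1..r. f j (s j))) summable_on index_tuples m r"
    by (rule summable_on_cmult_right)
  then show ?thesis
  proof (rule summable_on_comparison_test)
    fix s assume s: "s \<in> index_tuples m r"
    have sr: "- (int m div 2) \<le> s r"
      using s by (simp add: index_tuples_def floor_half_nat)
    have "norm (chain_weight q m r i 1 s) = (\<Prod>j=1..<r. f j (s j) * norm (link q r j (s j - s (Suc j))))
       * (f r (s r) * norm (bweight q (int m) (s r)))"
    proof -
      have "norm (q powi ((s j)\<^sup>2 + (int m - (if j \<le> i then 1 else 0)) * s j)) = f j (s j)"
        if "j \<in> {1..<r}" for j
        using that by (simp add: f_def b_def norm_power_int)
      moreover have "norm (q powi (s r)\<^sup>2) = f r (s r)"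
        by (simp add: f_def b_def norm_power_int)
      ultimately show ?thesis
        unfolding chain_weight_def norm_mult prod_norm [symmetric]
        by (intro arg_cong2[of _ _ _ _ "(*)"] prod.cong refl) auto
    qed
    also have "\<dots> \<le> (\<Prod>j=1..<r. f j (s j) * C) * (f r (s r) * B)"
      by (intro mult_mono prod_mono conjI mult_nonneg_nonneg prod_nonneg f_nonneg C B sr ballI) auto
    also have "\<dots> = C ^ (r - 1) * B * (\<Prod>j=1..r. f j (s j))"
    proof -
      have "{1..r} = insert r {1..<r}"
        using r by auto
      then show ?thesis
        by (simp add: prod.distrib mult_ac)
    qed
    finally show "norm (chain_weight q m r i 1 s) \<le> C ^ (r - 1) * B * (\<Prod>j=1..r. f j (s j))" .
  qed auto
qed

text \<open>The factor \<open>1 / (q)_(N - s_1)\<close> enforces \<open>s_1 <= N\<close> by itself,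
  so the sum may run over all tuples; this factor tends to \<open>1 / (q)_inf\<close>.\<close>

lemma chain_sum_LIMSEQ_tuples:
  fixes q :: complex
  assumes q: "q \<noteq> 0" "norm q < 1" and r: "r \<ge> 2"
  shows "(\<lambda>N. chain_sum q m r i 0 (int N)) \<longlonglongrightarrow>
     infsum (chain_weight q m r i 1) (index_tuples m r) / qpoch_inf q q"
proof -
  obtain C where C: "C \<ge> 1" "\<And>k. norm (rqfac q k) \<le> C"
    using rqfac_bounded[OF q(2)] by blast
  define f where "f = (\<lambda>N s. rqfac q (int N - s 1) * chain_weight q m r i 1 s)"
  have "chain_sum q m r i 0 (int N) = infsum (f N) (index_tuples m r)" for N
  proof -
    have "chain_sum q m r i 0 (int N) = sum (f N) (chain_tuples m r 1 (int N))"
      using r by (simp add: chain_sum_def f_def link_def)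
    also have "\<dots> = infsum (f N) (chain_tuples m r 1 (int N))"
      using finite_chain_tuples[of 1 r m "int N"] r by simp
    also have "\<dots> = infsum (f N) (index_tuples m r)"
      by (rule infsum_cong_neutral) (auto simp: chain_tuples_index_tuples[unfolded One_nat_def] f_def rqfac_def)
    finally show ?thesis .
  qed
  moreover have "(\<lambda>N. infsum (f N) (index_tuples m r)) \<longlonglongrightarrow>
     infsum (\<lambda>s. 1 / qpoch_inf q q * chain_weight q m r i 1 s) (index_tuples m r)"
  proof (rule tannery_infsum(1))
    show "(\<lambda>s. C * norm (chain_weight q m r i 1 s)) summable_on index_tuples m r"
      by (intro summable_on_cmult_right chain_weight_summable q r)
    show "norm (f N s) \<le> C * norm (chain_weight q m r i 1 s)" for N s
      unfolding f_def norm_mult using C by (intro mult_right_mono) auto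
    show "(\<lambda>N. f N s) \<longlonglongrightarrow> 1 / qpoch_inf q q * chain_weight q m r i 1 s" for s
      unfolding f_def using rqfac_LIMSEQ[OF q(2), of "- s 1"] by (intro tendsto_intros) auto
  qed
  ultimately show ?thesis
    unfolding infsum_cmult_right' by simp
qed

text \<open>Bounds the denominators of \<open>balpha\<close> uniformly. For negative
  \<open>c\<close>, pulling out \<open>q^c\<close>, of modulus at least 1, leads back to the
  exponent \<open>-c\<close>.\<close>

lemma norm_one_plus_powi_ge:
  fixes q :: complex
  assumes q: "q \<noteq> 0" "norm q < 1"
  shows "norm (1 + q powi c) \<ge> 1 - norm q"
proof -
  have nat: "norm (1 + q ^ n) \<ge> 1 - norm q" for n
  proof (cases n)
    case (Suc k)
    have "norm q ^ n \<le> norm q ^ 1"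
      using q Suc by (intro power_decreasing) auto
    then have "norm (q ^ n) \<le> norm q"
      by (simp add: norm_power)
    moreover have "norm (1 + q ^ n) \<ge> norm (1 :: complex) - norm (q ^ n)"
      by (rule norm_diff_ineq)
    ultimately show ?thesis
      by simp
  qed (use norm_ge_zero[of q] in \<open>simp add: algebra_simps del: norm_ge_zero\<close>)
  show ?thesis
  proof (cases "c \<ge> 0")
    case True
    then show ?thesis
      using nat[of "nat c"] power_int_of_nat[of q "nat c"] by simp
  next
    case False
    define n where "n = nat (- c)"
    have c: "q powi c = inverse (q ^ n)"
      unfolding power_int_of_nat[symmetric] power_int_minus[symmetric] using False by (simp add: n_def)
    have "1 + q powi c = inverse (q ^ n) * (1 + q ^ n)"
      unfolding c using q by (simp add: algebra_simps)
    then have "norm (1 + q powi c) = inverse (norm q ^ n) * norm (1 + q ^ n)"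
      by (simp add: norm_mult norm_inverse norm_power)
    also have "\<dots> \<ge> 1 * norm (1 + q ^ n)"
      using q by (intro mult_right_mono one_le_inverse) (auto simp: power_le_one)
    finally show ?thesis
      using nat[of n] by simp
  qed
qed

text \<open>The termwise limit of \<open>chain_sum_eq\<close> at \<open>b = 0\<close>, apart from
  the constant due to the kernel: \<open>q^(N+j+m)\<close> tends to 0 and removes the
  \<open>A_i\<close> part of the bracket.\<close>

definition bilateral_term :: "complex \<Rightarrow> nat \<Rightarrow> nat \<Rightarrow> nat \<Rightarrow> int \<Rightarrow> complex" where
  "bilateral_term q m r i j = balpha q (int m) j *
     q powi (int (r - 1) * (j\<^sup>2 + int m * j) - int i * j) * geo (Suc i) (q powi (2 * j + int m))"

lemma chain_sum_LIMSEQ_bilateral: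
  fixes q :: complex
  assumes q: "q \<noteq> 0" "norm q < 1" and i: "i < r"
  shows "(\<lambda>N. chain_sum q m r i 0 (int N)) \<longlonglongrightarrow>
     infsum (bilateral_term q m r i) UNIV / (qpoch_inf q q)\<^sup>2"
    and "bilateral_term q m r i summable_on UNIV"
proof -
  obtain C where C: "C \<ge> 1" "\<And>k. norm (rqfac q k) \<le> C"
    using rqfac_bounded[OF q(2)] by blast
  define \<rho> where "\<rho> = norm q"
  have \<rho>: "0 < \<rho>" "\<rho> < 1"
    using q by (auto simp: \<rho>_def)
  define y where "y = (\<lambda>j. q powi (2 * j + int m))"
  define F where "F = (\<lambda>j. q powi (int (r - 1) * (j\<^sup>2 + int m * j) - int i * j))"
  define f where "f = (\<lambda>N j. balpha q (int m) j * F j *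
      (geo (Suc i) (y j) - q powi (int N + j + int m) * geo i (y j)) * bkernel q (int m) (int N) j)"
  \<comment> \<open>Expanding \<open>A_e\<close> in powers of \<open>y\<close> gives finitely many
    Gaussians in \<open>j\<close>. The \<open>2\<close> pays for the two parts of the bracket,
    \<open>C^2\<close> for the kernel, \<open>1 - \<rho>\<close> for the denominator of
    \<open>balpha\<close>.\<close>
  define h where "h = (\<lambda>j. 2 * C\<^sup>2 / (1 - \<rho>) * (\<Sum>k<Suc i. \<rho> powi (int (k * m)) *
      \<rho> powi (int r * j\<^sup>2 + (int (r - 1) * int m - int i + 2 * int k) * j)))"
  have h: "h summable_on UNIV"
  proof -
    have "(\<lambda>j. \<Sum>k<Suc i. \<rho> powi (int (k * m)) *
      \<rho> powi (int r * j\<^sup>2 + (int (r - 1) * int m - int i + 2 * int k) * j)) summable_on UNIV"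
      using \<rho> i
      by (intro has_sum_imp_summable[OF has_sum_finite_sum[OF _ has_sum_infsum]] summable_on_cmult_right
            summable_on_gaussian_int) auto
    then show ?thesis
      unfolding h_def by (rule summable_on_cmult_right)
  qed
  have bound: "norm (f N j) \<le> h j" for N j
  \<comment> \<open>For \<open>N + j + m < 0\<close> the power \<open>q^(N+j+m)\<close> may be large
    but the kernel is zero; otherwise that power has modulus at most 1.\<close>
  proof (cases "int N + j + int m < 0")
    case True
    have "\<rho> powi k \<ge> 0" for k
      using \<rho> by simp
    then have "h j \<ge> 0"
      unfolding h_def using \<rho> by (intro mult_nonneg_nonneg sum_nonneg divide_nonneg_nonneg) auto
    then show ?thesis
      using True by (simp add: f_def bkernel_eq_0)
  next
    case False
    have nb: "norm (balpha q (int m) j) \<le> \<rho> powi j\<^sup>2 / (1 - \<rho>)"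
      unfolding balpha_def norm_divide norm_mult norm_power_int
      using norm_one_plus_powi_ge[OF q, of "2 * j + int m"] \<rho>
      by (auto simp: \<rho>_def intro!: frac_le)
    have w: "norm (q powi (int N + j + int m)) \<le> 1"
    proof -
      have "q powi (int N + j + int m) = q ^ nat (int N + j + int m)"
        using False power_int_of_nat[of q "nat (int N + j + int m)"] by simp
      then show ?thesis
        using q by (simp add: norm_power power_le_one)
    qed
    have gn: "norm (geo e (y j)) \<le> (\<Sum>k<Suc i. norm (y j) ^ k)" if "e \<le> Suc i" for e
    proof -
      have "norm (geo e (y j)) \<le> (\<Sum>k<e. norm (y j) ^ k)"
        unfolding geo_def by (rule order_trans[OF norm_sum]) (simp add: norm_power)
      also have "\<dots> \<le> (\<Sum>k<Suc i. norm (y j) ^ k)"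
        using that by (intro sum_mono2) auto
      finally show ?thesis .
    qed
    have "norm (geo (Suc i) (y j) - q powi (int N + j + int m) * geo i (y j)) \<le>
       norm (geo (Suc i) (y j)) + norm (q powi (int N + j + int m)) * norm (geo i (y j))"
      unfolding norm_mult[symmetric] by (rule norm_triangle_ineq4)
    also have "\<dots> \<le> (\<Sum>k<Suc i. norm (y j) ^ k) + 1 * (\<Sum>k<Suc i. norm (y j) ^ k)"
      using w by (intro add_mono mult_mono gn) (auto intro: sum_nonneg)
    finally have ng: "norm (geo (Suc i) (y j) - q powi (int N + j + int m) * geo i (y j)) \<le>
       2 * (\<Sum>k<Suc i. norm (y j) ^ k)"
      by simp
    have nk: "norm (bkernel q (int m) (int N) j) \<le> C\<^sup>2"
      unfolding bkernel_def norm_mult power2_eq_square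
      using C by (intro mult_mono) (auto intro: order_trans[of 0 1 C])
    have "norm (f N j) \<le> \<rho> powi j\<^sup>2 / (1 - \<rho>) * norm (F j) * (2 * (\<Sum>k<Suc i. norm (y j) ^ k)) * C\<^sup>2"
      unfolding f_def norm_mult using \<rho>
      by (intro mult_mono nb ng nk order_refl mult_nonneg_nonneg norm_ge_zero sum_nonneg) auto
    also have "\<dots> = 2 * C\<^sup>2 / (1 - \<rho>) * (\<Sum>k<Suc i. \<rho> powi j\<^sup>2 * norm (F j) * norm (y j) ^ k)"
      by (simp add: sum_distrib_left sum_divide_distrib mult_ac del: sum.lessThan_Suc)
    also have "\<dots> = h j"
    proof -
      have "\<rho> powi j\<^sup>2 * norm (F j) * norm (y j) ^ k = \<rho> powi (int (k * m)) *
          \<rho> powi (int r * j\<^sup>2 + (int (r - 1) * int m - int i + 2 * int k) * j)" for k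
      proof -
        have "norm (y j) ^ k = \<rho> powi ((2 * j + int m) * int k)"
          unfolding y_def norm_power_int \<rho>_def[symmetric] by (simp only: power_int_mult power_int_of_nat)
        moreover have "norm (F j) = \<rho> powi (int (r - 1) * (j\<^sup>2 + int m * j) - int i * j)"
          unfolding F_def norm_power_int \<rho>_def ..
        moreover have "j\<^sup>2 + (int (r - 1) * (j\<^sup>2 + int m * j) - int i * j) + (2 * j + int m) * int k =
          int (k * m) + (int r * j\<^sup>2 + (int (r - 1) * int m - int i + 2 * int k) * j)"
        proof -
          have "int (r - 1) = int r - 1"
            using i by auto
          then show ?thesis
            by (simp add: algebra_simps)
        qed
        moreover have "\<rho> \<noteq> 0"
          using \<rho> by simp
        ultimately show ?thesis
          by (simp only: power_int_add [symmetric] simp_thms)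
      qed
      then show ?thesis
        unfolding h_def by simp
    qed
    finally show ?thesis .
  qed
  have lim: "(\<lambda>N. f N j) \<longlonglongrightarrow> bilateral_term q m r i j * (1 / (qpoch_inf q q)\<^sup>2)" for j
  proof -
    have k: "(\<lambda>N. bkernel q (int m) (int N) j) \<longlonglongrightarrow> 1 / qpoch_inf q q * (1 / qpoch_inf q q)"
      unfolding bkernel_def using rqfac_LIMSEQ[OF q(2), of "-j"] rqfac_LIMSEQ[OF q(2), of "j + int m"]
      by (intro tendsto_intros) (auto simp: add.assoc)
    have "(\<lambda>N. q powi (j + int m) * q ^ N) \<longlonglongrightarrow> q powi (j + int m) * 0"
      using q by (intro tendsto_intros LIMSEQ_power_zero)
    moreover have "q powi (j + int m) * q ^ N = q powi (int N + j + int m)" for N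
      using powi_mult_power[OF q(1), of "j + int m" N] by (simp add: add_ac)
    ultimately have w: "(\<lambda>N. q powi (int N + j + int m)) \<longlonglongrightarrow> 0"
      by simp
    have "(\<lambda>N. f N j) \<longlonglongrightarrow> balpha q (int m) j * F j *
      (geo (Suc i) (y j) - 0 * geo i (y j)) * (1 / qpoch_inf q q * (1 / qpoch_inf q q))"
      unfolding f_def by (intro tendsto_intros k w)
    then show ?thesis
      by (simp add: bilateral_term_def F_def y_def power2_eq_square mult.assoc)
  qed
  have "infsum (f N) UNIV = chain_sum q m r i 0 (int N)" for N
  proof -
    have "infsum (f N) UNIV = infsum (f N) {-int m-int N..int N}"
      by (rule infsum_cong_neutral) (auto simp: f_def bkernel_eq_0)
    also have "\<dots> = sum (f N) {-int m-int N..int N}"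
      by simp
    also have "\<dots> = chain_sum q m r i 0 (int N)"
      using chain_sum_eq[OF q(2) q(1) i, of 0 m "int N"] i by (simp add: f_def F_def y_def)
    finally show ?thesis .
  qed
  with tannery_infsum(1)[OF bound h lim]
  show "(\<lambda>N. chain_sum q m r i 0 (int N)) \<longlonglongrightarrow> infsum (bilateral_term q m r i) UNIV / (qpoch_inf q q)\<^sup>2"
    by (simp only: infsum_cmult_left') simp
  have "(\<lambda>j. bilateral_term q m r i j * (1 / (qpoch_inf q q)\<^sup>2)) summable_on UNIV"
    by (rule tannery_infsum(2)[OF bound h lim])
  from summable_on_cmult_left[OF this, of "(qpoch_inf q q)\<^sup>2"]
  show "bilateral_term q m r i summable_on UNIV"
    using qpoch_inf_self_nonzero[OF q(2)] by simp
qed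

section \<open>Symmetrization\<close>

context
  fixes q :: complex and m r i :: nat
  assumes q: "q \<noteq> 0" "norm q < 1" and i: "i < r"
begin

text \<open>The general term of a theta series: \<open>bilateral_term\<close> stripped of
  \<open>A_(i+1)(y) / (1 + y)\<close>.\<close>

definition theta_term :: "int \<Rightarrow> complex" where
  "theta_term j = (-1) powi j * q powi (int r * j\<^sup>2 + (int m * int (r - 1) - int i) * j)"

definition theta_base :: "int \<Rightarrow> complex" where
  "theta_base j = q powi (2 * j + int m)"

lemma theta_base_nonzero: "theta_base j \<noteq> 0"
  using q by (simp add: theta_base_def)

lemma theta_base_reflect: "theta_base (- int m - j) = inverse (theta_base j)"
  unfolding theta_base_def power_int_minus [symmetric] by (simp add: algebra_simps)

lemma theta_base_power: "theta_base j ^ n = q powi ((2 * j + int m) * int n)"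
  unfolding theta_base_def by (simp only: power_int_mult power_int_of_nat)

lemma theta_term_reflect: "theta_term (- int m - j) = (-1) ^ m * theta_base j ^ (m + i) * theta_term j"
proof -
  have "(-1 :: complex) powi (- int m - j) = (-1) ^ m * (-1) powi j"
    by (simp add: power_int_diff power_int_minus divide_inverse flip: power_inverse power_int_inverse)
  moreover have "q powi (int r * (- int m - j)\<^sup>2 + (int m * int (r - 1) - int i) * (- int m - j)) =
     theta_base j ^ (m + i) * q powi (int r * j\<^sup>2 + (int m * int (r - 1) - int i) * j)"
  proof -
    have r: "int r = int (r - 1) + 1"
      using i by auto
    have "int r * (- int m - j)\<^sup>2 + (int m * int (r - 1) - int i) * (- int m - j) =
      (2 * j + int m) * int (m + i) + (int r * j\<^sup>2 + (int m * int (r - 1) - int i) * j)"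
      unfolding r by (simp add: algebra_simps power2_eq_square)
    then show ?thesis
      unfolding theta_base_power using q(1) power_int_add by metis
  qed
  ultimately show ?thesis
    by (simp add: theta_term_def)
qed

lemma geo_reflect:
  assumes "y \<noteq> 0"
  shows "y ^ e * geo (Suc e) (inverse y) = geo (Suc e) y"
proof -
  have "y ^ e * geo (Suc e) (inverse y) = (\<Sum>k<Suc e. y ^ (e - k))"
    unfolding geo_def sum_distrib_left using assms
    by (intro sum.cong refl) (auto simp: power_diff divide_inverse power_inverse)
  also have "\<dots> = (\<Sum>k<Suc e. y ^ k)"
    using sum.nat_diff_reindex[of "\<lambda>k. y ^ k" "Suc e"] by simp
  finally show ?thesis
    by (simp add: geo_def)
qed

lemma geo_mult: "(1 - y) * geo e y = 1 - y ^ e"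
  unfolding geo_def by (simp add: one_diff_power_eq)

lemma bilateral_term_eq:
  "bilateral_term q m r i j = theta_term j * geo (Suc i) (theta_base j) / (1 + theta_base j)"
proof -
  have r: "int r = int (r - 1) + 1"
    using i by auto
  have "j\<^sup>2 + (int (r - 1) * (j\<^sup>2 + int m * j) - int i * j) =
     int r * j\<^sup>2 + (int m * int (r - 1) - int i) * j"
    unfolding r by (simp add: algebra_simps)
  then have "q powi j\<^sup>2 * q powi (int (r - 1) * (j\<^sup>2 + int m * j) - int i * j) =
    q powi (int r * j\<^sup>2 + (int m * int (r - 1) - int i) * j)"
    using q(1) power_int_add by metis
  then show ?thesis
    unfolding bilateral_term_def balpha_def theta_term_def theta_base_def [symmetric]
    by (metis (no_types, lifting) mult.assoc times_divide_eq_left)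
qed

text \<open>Reflection sends \<open>y\<close> to \<open>1/y\<close>; as \<open>A_(i+1)\<close> is
  palindromic, the second term is \<open>(-1)^m y^(m+1)\<close> times the first. The quotient
  \<open>(1 + (-1)^m y^(m+1)) / (1 + y)\<close> is a geometric sum in \<open>-y\<close>, so the
  denominator disappears.\<close>

lemma bilateral_term_symmetrized:
  "bilateral_term q m r i j + bilateral_term q m r i (- int m - j) =
     theta_term j * geo (Suc i) (theta_base j) * geo (Suc m) (- theta_base j)"
proof -
  define y where "y = theta_base j"
  have y: "y \<noteq> 0"
    by (simp add: y_def theta_base_nonzero)
  have nz: "1 + y \<noteq> 0"
    using norm_one_plus_powi_ge[OF q, of "2 * j + int m"] q unfolding y_def theta_base_def by auto
  have inv: "1 + inverse y = (1 + y) / y"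
    using y by (simp add: field_simps)
  have "bilateral_term q m r i (- int m - j) =
     (-1) ^ m * y ^ m * theta_term j * (y ^ i * geo (Suc i) (inverse y)) / (1 + inverse y)"
    unfolding bilateral_term_eq theta_term_reflect theta_base_reflect y_def
    by (simp only: power_add mult_ac)
  also have "\<dots> = theta_term j * geo (Suc i) y * ((-1) ^ m * y ^ Suc m) / (1 + y)"
    unfolding geo_reflect[OF y] inv using y by simp
  finally have "bilateral_term q m r i j + bilateral_term q m r i (- int m - j) =
    theta_term j * geo (Suc i) y * ((1 + (-1) ^ m * y ^ Suc m) / (1 + y))"
    unfolding bilateral_term_eq y_def [symmetric] by (simp add: add_divide_distrib distrib_left)
  also have "(1 + (-1) ^ m * y ^ Suc m) / (1 + y) = geo (Suc m) (- y)"
  proof -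
    have "(1 + y) * geo (Suc m) (- y) = 1 - (- y) ^ Suc m"
      using geo_mult[of "- y" "Suc m"] by simp
    also have "\<dots> = 1 + (-1) ^ m * y ^ Suc m"
      by (simp add: power_minus[of y])
    finally show ?thesis
      using nz by (metis nonzero_mult_div_cancel_left)
  qed
  finally show ?thesis
    by (simp add: y_def)
qed

section \<open>Theta series and the closed forms for even and odd \<open>m\<close>\<close>

lemma infsum_symmetrize:
  fixes g :: "int \<Rightarrow> complex"
  assumes "g summable_on UNIV"
  shows "((\<lambda>j. g j + g (- int m - j)) has_sum 2 * infsum g UNIV) UNIV"
proof -
  have "(g has_sum infsum g UNIV) UNIV"
    using assms by simp
  moreover from this have "((\<lambda>j. g (- int m - j)) has_sum infsum g UNIV) UNIV"
    by (subst has_sum_reindex_bij_witness[of _ "\<lambda>j. - int m - j" "\<lambda>j. - int m - j" UNIV g]) auto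
  ultimately show ?thesis
    using has_sum_add by fastforce
qed

text \<open>In Jacobi's identity \<open>y^n = q^(mn) q^(2jn)\<close> adds \<open>2n\<close> to the
  linear coefficient and yields the prefactor; the extra \<open>r\<close> in the parameter
  compensates for \<open>j^2 - j\<close> in place of \<open>j^2\<close>.\<close>

lemma theta_has_sum:
  "((\<lambda>j. theta_term j * theta_base j ^ n) has_sum q ^ (m * n) *
      qpoch_infs [q ^ (2 * r), q powi (int m * int (r - 1) + int r - int i + 2 * int n),
        q powi (2 * int r - (int m * int (r - 1) + int r - int i + 2 * int n))] (q ^ (2 * r))) UNIV"
proof -
  define A where "A = int m * int (r - 1) + int r - int i + 2 * int n"
  have eq: "q ^ (m * n) * ((-1) powi j * q powi (int r * (j\<^sup>2 - j) + A * j)) = theta_term j * theta_base j ^ n" for j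
  proof -
    have e: "int r * (j\<^sup>2 - j) + A * j + int (m * n) =
       (int r * j\<^sup>2 + (int m * int (r - 1) - int i) * j) + (2 * j + int m) * int n"
      unfolding A_def by (simp add: algebra_simps)
    have "q powi (int r * (j\<^sup>2 - j) + A * j) * q ^ (m * n) =
       q powi (int r * j\<^sup>2 + (int m * int (r - 1) - int i) * j) * theta_base j ^ n"
      unfolding theta_base_power powi_mult_power[OF q(1)] e using q(1) by (intro power_int_add) simp
    then have "(-1) powi j * (q powi (int r * (j\<^sup>2 - j) + A * j) * q ^ (m * n)) = theta_term j * theta_base j ^ n"
      by (simp only: theta_term_def mult.assoc)
    then show ?thesis
      by (simp only: mult_ac)
  qed
  have "((\<lambda>j. q ^ (m * n) * ((-1) powi j * q powi (int r * (j\<^sup>2 - j) + A * j))) has_sum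
     q ^ (m * n) * qpoch_infs [q ^ (2 * r), q powi A, q powi (2 * int r - A)] (q ^ (2 * r))) UNIV"
    using i by (intro has_sum_cmult_right jacobi_triple_product q) auto
  then show ?thesis
    unfolding eq unfolding A_def .
qed

text \<open>Both geometric sums are expanded, and each power \<open>y^(k+l)\<close> gives one theta
  series. The \<open>2\<close> in the denominator of \<open>a_even\<close> comes from adding the
  reflected series.\<close>

lemma infsum_bilateral_even:
  assumes m: "m = 2 * p"
  shows "infsum (bilateral_term q m r i) UNIV = a_even q r i p * qpoch_inf q q"
proof -
  have "((\<lambda>j. theta_term j * geo (Suc i) (theta_base j) * geo (Suc m) (- theta_base j)) has_sum
     2 * infsum (bilateral_term q m r i) UNIV) UNIV"
    using infsum_symmetrize[OF chain_sum_LIMSEQ_bilateral(2)[OF q i, of m]]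
    by (simp only: bilateral_term_symmetrized)
  moreover have "((\<lambda>j. theta_term j * geo (Suc i) (theta_base j) * geo (Suc m) (- theta_base j)) has_sum
     2 * (a_even q r i p * qpoch_inf q q)) UNIV"
  proof -
    define T where "T = (\<lambda>n. q ^ (m * n) *
      qpoch_infs [q ^ (2 * r), q powi (int m * int (r - 1) + int r - int i + 2 * int n),
        q powi (2 * int r - (int m * int (r - 1) + int r - int i + 2 * int n))] (q ^ (2 * r)))"
    have "((\<lambda>j. \<Sum>k=0..i. \<Sum>l=0..m. (-1) ^ l * (theta_term j * theta_base j ^ (k + l))) has_sum
       (\<Sum>k=0..i. \<Sum>l=0..m. (-1) ^ l * T (k + l))) UNIV"
      unfolding T_def by (intro has_sum_finite_sum has_sum_cmult_right theta_has_sum) auto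
    moreover have "(\<Sum>k=0..i. \<Sum>l=0..m. (-1) ^ l * (theta_term j * theta_base j ^ (k + l))) =
       theta_term j * geo (Suc i) (theta_base j) * geo (Suc m) (- theta_base j)" for j
    proof -
      have "theta_term j * geo (Suc i) (theta_base j) * geo (Suc m) (- theta_base j) =
        theta_term j * ((\<Sum>k=0..i. theta_base j ^ k) * (\<Sum>l=0..m. (- theta_base j) ^ l))"
        unfolding geo_def by (simp only: lessThan_Suc_atMost atLeast0AtMost mult.assoc)
      also have "\<dots> = (\<Sum>k=0..i. \<Sum>l=0..m. (-1) ^ l * (theta_term j * theta_base j ^ (k + l)))"
        unfolding sum_product unfolding sum_distrib_left
        by (intro sum.cong refl) (simp add: power_add power_minus[of "theta_base j"])
      finally show ?thesis ..
    qed
    moreover have "(\<Sum>k=0..i. \<Sum>l=0..m. (-1) ^ l * T (k + l)) = 2 * (a_even q r i p * qpoch_inf q q)"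
    proof -
      have "2 * (x / (2 * qpoch_inf q q) * qpoch_inf q q) = x" for x
        using qpoch_inf_self_nonzero[OF q(2)] by simp
      then have "2 * (a_even q r i p * qpoch_inf q q) = (\<Sum>k=0..i. \<Sum>l=0..2*p. (-1) ^ l * q ^ (2*p*k + 2*p*l) *
        qpoch_infs
           [q ^ (2*r),
            q powi (2 * int p * (int r - 1) + int r - int i + 2 * int k + 2 * int l),
            q powi (int r + int i - 2 * int p * (int r - 1) - 2 * int k - 2 * int l)]
           (q ^ (2*r)))"
        unfolding a_even_def by (simp add: sum_distrib_left sum_distrib_right mult.assoc)
      also have "\<dots> = (\<Sum>k=0..i. \<Sum>l=0..m. (-1) ^ l * T (k + l))"
        unfolding m
      proof (intro sum.cong refl)
        fix k l
        have 1: "int m * int (r - 1) + int r - int i + 2 * int (k + l) =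
            2 * int p * (int r - 1) + int r - int i + 2 * int k + 2 * int l"
          using i by (simp add: m of_nat_diff)
        have 2: "2 * int r - (int m * int (r - 1) + int r - int i + 2 * int (k + l)) =
            int r + int i - 2 * int p * (int r - 1) - 2 * int k - 2 * int l"
          unfolding 1 by simp
        have 3: "m * (k + l) = 2 * p * k + 2 * p * l"
          by (simp add: m algebra_simps)
        show "(-1) ^ l * q ^ (2*p*k + 2*p*l) * qpoch_infs
           [q ^ (2*r),
            q powi (2 * int p * (int r - 1) + int r - int i + 2 * int k + 2 * int l),
            q powi (int r + int i - 2 * int p * (int r - 1) - 2 * int k - 2 * int l)]
           (q ^ (2*r)) = (-1) ^ l * T (k + l)"
          unfolding T_def 2 unfolding 1 3 by (simp only: mult.assoc)
      qed
      finally show ?thesis ..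
    qed
    ultimately show ?thesis
      by simp
  qed
  ultimately show ?thesis
    using has_sum_unique by fastforce
qed

text \<open>For odd \<open>m\<close>, \<open>A_(m+1)(-y) = (1 - y) A_(p+1)(y^2)\<close>, and
  \<open>(1 - y) A_(i+1)(y) = 1 - y^(i+1)\<close>. The two resulting parts are \<open>H\<close> and
  its reflection, so the series has the same value as \<open>H\<close> alone, a single sum of theta
  series without the factor \<open>1/2\<close>.\<close>

lemma infsum_bilateral_odd:
  assumes m: "m = 2 * p + 1"
  shows "infsum (bilateral_term q m r i) UNIV = a_odd q r i p * qpoch_inf q q"
proof -
  define H where "H = (\<lambda>j. theta_term j * geo (Suc p) ((theta_base j)\<^sup>2))"
  define c where "c = (-1) ^ p * q powi ((2 - int r) * (int p)\<^sup>2 + (1 + int i - int r) * int p)"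
  define T where "T = (\<lambda>l. qpoch_infs
           [q ^ (2*r),
            q powi (2 * int r - 2 * int p - 1 - int i + 4 * int l),
            q powi (int i + 2 * int p + 1 - 4 * int l)]
           (q ^ (2*r)))"
  have T: "((\<lambda>j. theta_term j * ((theta_base j)\<^sup>2) ^ l) has_sum c * q ^ (2 * l) * T l) UNIV" for l
  proof -
    define A where "A = 2 * int r - 2 * int p - 1 - int i + 4 * int l"
    define f where "f = (\<lambda>j. (-1) powi j * q powi (int r * (j\<^sup>2 - j) + A * j))"
    have A: "2 * int r - A = int i + 2 * int p + 1 - 4 * int l"
      by (simp add: A_def)
    have "(f has_sum T l) UNIV"
      using jacobi_triple_product[OF q, of r A] i unfolding f_def T_def A unfolding A_def by simp
    \<comment> \<open>Shifting \<open>j\<close> by \<open>p\<close> lowers the parameter found in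
      \<open>theta_has_sum\<close> by \<open>2pr\<close>; the sign and the powers of
      \<open>q\<close> left over make up \<open>c * q ^ (2 * l)\<close>.\<close>
    then have "((\<lambda>j. f (j + int p)) has_sum T l) UNIV"
      by (subst has_sum_reindex_bij_witness[of _ "\<lambda>j. j - int p" "\<lambda>j. j + int p" UNIV f]) auto
    then have "((\<lambda>j. c * q ^ (2 * l) * f (j + int p)) has_sum c * q ^ (2 * l) * T l) UNIV"
      by (rule has_sum_cmult_right)
    moreover have "c * q ^ (2 * l) * f (j + int p) = theta_term j * ((theta_base j)\<^sup>2) ^ l" for j
    proof -
      define a1 a2 a3 where "a1 = (2 - int r) * (int p)\<^sup>2 + (1 + int i - int r) * int p"
        and "a2 = int r * ((j + int p)\<^sup>2 - (j + int p)) + A * (j + int p)"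
        and "a3 = int r * j\<^sup>2 + (int m * int (r - 1) - int i) * j"
      have r: "int (r - 1) = int r - 1"
        using i by auto
      have e: "a1 + int (2 * l) + a2 = a3 + (2 * j + int m) * int (2 * l)"
        unfolding a1_def a2_def a3_def A_def r by (simp add: m algebra_simps power2_eq_square)
      have "q powi a1 * q ^ (2 * l) * q powi a2 = q powi (a1 + int (2 * l) + a2)"
        using q(1) powi_mult_power[OF q(1), of a1 "2 * l"] by (simp only: power_int_add simp_thms)
      also have "\<dots> = q powi a3 * theta_base j ^ (2 * l)"
        unfolding e theta_base_power using q(1) by (simp only: power_int_add simp_thms)
      finally have pw: "q powi a1 * q ^ (2 * l) * q powi a2 = q powi a3 * theta_base j ^ (2 * l)" .
      have sgn: "(-1) ^ p * (-1) powi (j + int p) = (-1 :: complex) powi j"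
        by (simp add: power_int_add flip: power_add mult_2 mult.assoc)
      have "c * q ^ (2 * l) * f (j + int p) =
        ((-1) ^ p * (-1) powi (j + int p)) * (q powi a1 * q ^ (2 * l) * q powi a2)"
        unfolding c_def f_def a1_def a2_def by (simp only: mult_ac)
      also have "\<dots> = theta_term j * ((theta_base j)\<^sup>2) ^ l"
        unfolding pw sgn theta_term_def a3_def[symmetric] unfolding power_mult by (simp only: mult.assoc)
      finally show ?thesis .
    qed
    ultimately show ?thesis
      by simp
  qed
  have "((\<lambda>j. \<Sum>l<Suc p. theta_term j * ((theta_base j)\<^sup>2) ^ l) has_sum (\<Sum>l<Suc p. c * q ^ (2 * l) * T l)) UNIV"
    by (intro has_sum_finite_sum T) auto
  then have H: "(H has_sum (\<Sum>l<Suc p. c * q ^ (2 * l) * T l)) UNIV"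
    unfolding H_def geo_def sum_distrib_left .
  have sym: "bilateral_term q m r i j + bilateral_term q m r i (- int m - j) = H j + H (- int m - j)" for j
  proof -
    define y where "y = theta_base j"
    have y: "y \<noteq> 0"
      by (simp add: y_def theta_base_nonzero)
    have geo: "geo (Suc m) (- y) = (1 - y) * geo (Suc p) (y\<^sup>2)"
    proof -
      have "geo (2 * n) (- y) = (1 - y) * geo n (y\<^sup>2)" for n
      proof (induction n)
        case (Suc n)
        have even: "(- y) ^ (2 * n) = (y\<^sup>2) ^ n"
          by (simp add: power_mult)
        have "geo (2 * Suc n) (- y) = geo (2 * n) (- y) + (- y) ^ (2 * n) - y * (- y) ^ (2 * n)"
          by simp
        also have "\<dots> = (1 - y) * geo (Suc n) (y\<^sup>2)"
          unfolding Suc even by (simp add: algebra_simps)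
        finally show ?case .
      qed simp
      moreover have "Suc m = 2 * Suc p"
        using m by simp
      ultimately show ?thesis
        by (simp only:)
    qed
    have odd: "(-1 :: complex) ^ m = - 1"
      by (simp add: m)
    have pow: "y ^ (m + i) = y ^ Suc i * (y\<^sup>2) ^ p"
      by (simp add: m power_add power_mult)
    have "y ^ (m + i) * geo (Suc p) (inverse (y\<^sup>2)) = y ^ Suc i * ((y\<^sup>2) ^ p * geo (Suc p) (inverse (y\<^sup>2)))"
      unfolding pow by (simp only: mult.assoc)
    also have "\<dots> = y ^ Suc i * geo (Suc p) (y\<^sup>2)"
      using y by (subst geo_reflect) auto
    finally have geo': "y ^ (m + i) * geo (Suc p) (inverse (y\<^sup>2)) = y ^ Suc i * geo (Suc p) (y\<^sup>2)" .
    have "H (- int m - j) = - (theta_term j * (y ^ (m + i) * geo (Suc p) (inverse (y\<^sup>2))))"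
      unfolding H_def theta_term_reflect theta_base_reflect y_def[symmetric] power_inverse odd
      by (simp only: mult_ac mult_minus_left mult_minus_right mult_1_left)
    then have "H j + H (- int m - j) = theta_term j * geo (Suc p) (y\<^sup>2) - theta_term j * (y ^ Suc i * geo (Suc p) (y\<^sup>2))"
      unfolding geo' by (simp only: H_def y_def diff_conv_add_uminus)
    also have "\<dots> = theta_term j * (1 - y ^ Suc i) * geo (Suc p) (y\<^sup>2)"
      by (simp only: left_diff_distrib right_diff_distrib mult.assoc mult_1_left mult_1_right)
    also have "\<dots> = theta_term j * geo (Suc i) y * geo (Suc m) (- y)"
      unfolding geo geo_mult[symmetric] by (simp only: mult_ac)
    finally show ?thesis
      unfolding bilateral_term_symmetrized y_def ..
  qed
  have "2 * infsum (bilateral_term q m r i) UNIV = 2 * infsum H UNIV"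
    using infsum_symmetrize[OF chain_sum_LIMSEQ_bilateral(2)[OF q i, of m]]
      infsum_symmetrize[OF has_sum_imp_summable[OF H]] unfolding sym by (rule has_sum_unique)
  also have "infsum H UNIV = (\<Sum>l<Suc p. c * q ^ (2 * l) * T l)"
    using H by (rule infsumI)
  also have "\<dots> = a_odd q r i p * qpoch_inf q q"
  proof -
    have "a_odd q r i p = c * (\<Sum>l=0..p. q ^ (2 * l) * (T l / qpoch_inf q q))"
      unfolding a_odd_def c_def T_def ..
    then show ?thesis
      using qpoch_inf_self_nonzero[OF q(2)]
      by (simp add: sum_distrib_left sum_distrib_right lessThan_Suc_atMost atLeast0AtMost mult.assoc
          del: sum.lessThan_Suc)
  qed
  finally show ?thesis
    by simp
qed

end

theorem theorem2p6:
  fixes q :: complex and m r i :: nat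
  assumes "q \<noteq> 0" and "norm q < 1"
    and "r \<ge> 2" and "i \<le> r - 1"
  shows
    "((\<lambda>s. q powi ((\<Sum>j=1..r. (s j)\<^sup>2) + int m * (\<Sum>j=1..r-1. s j) - (\<Sum>j=1..i. s j))
             * qpoch (- q) q (int m + 2 * s r - 1)
             / ((\<Prod>j=1..r-2. qpoch q q (s j - s (Suc j)))
                * qpoch (q\<^sup>2) (q\<^sup>2) (s (r - 1) - s r))
             * (-1) powi (s r)
             * qbinom (q\<^sup>2) (int m + s r) (int m + 2 * s r))
       has_sum a_seq q r i m) (index_tuples m r)"
proof -
  have i: "i < r"
    using assms by auto
  \<comment> \<open>Two evaluations of the limit of \<open>chain_sum\<close>: one kernel factor
    survives on the side of the tuples, two on the bilateral side.\<close>
  have "infsum (chain_weight q m r i 1) (index_tuples m r) / qpoch_inf q q =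
     infsum (bilateral_term q m r i) UNIV / (qpoch_inf q q)\<^sup>2"
    by (rule LIMSEQ_unique[OF chain_sum_LIMSEQ_tuples[OF assms(1-3)]
          chain_sum_LIMSEQ_bilateral(1)[OF assms(1,2) i]])
  moreover have "infsum (bilateral_term q m r i) UNIV = a_seq q r i m * qpoch_inf q q"
  proof (cases "even m")
    case True
    then have "m = 2 * (m div 2)"
      by simp
    from infsum_bilateral_even[OF assms(1,2) i this] show ?thesis
      using True by (simp add: a_seq_def)
  next
    case False
    then have "m = 2 * (m div 2) + 1"
      by simp
    from infsum_bilateral_odd[OF assms(1,2) i this] show ?thesis
      using False by (simp add: a_seq_def)
  qed
  ultimately have "infsum (chain_weight q m r i 1) (index_tuples m r) = a_seq q r i m"
    using qpoch_inf_self_nonzero[OF assms(2)] by (simp add: field_simps power2_eq_square)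
  moreover have "chain_weight q m r i 1 summable_on index_tuples m r"
    by (rule abs_summable_summable[OF chain_weight_summable[OF assms(1-3)]])
  ultimately have "(chain_weight q m r i 1 has_sum a_seq q r i m) (index_tuples m r)"
    by (simp add: has_sum_iff)
  then show ?thesis
    by (subst has_sum_cong[OF summand_eq_chain_weight[OF assms]])
qed

end
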